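(* Let $d\ge 7$ be an integer, let $q\in\mathbb C$ be a primitive $d$-th root of unity, and let $\beta_3(-q):B_3\to \mathrm{GL}_2(\mathbb C)$ be the specialization of the reduced Burau representation $\beta_3$ at $t=-q$. Then $$\ker(\beta_3(-q))=\mathrm{ncl}_{B_3}(\sigma^d)\cdot\langle\tau_3^\ell\rangle,$$ where $\ell=2d/\gcd(12,d+6)$ is the order of the unit complex number $(-q)^3$.
   Context: $\mathrm{ncl}_G(S)$ denotes the normal closure of a set $S$ in a group $G$. $B_3$ is the braid group on $3$ strands with Artin generators $\sigma_1,\sigma_2$; $\sigma$ denotes one of these half-twist generators (they are conjugate), and $\tau_3=(\sigma_1\sigma_2)^3$ is the full twist, which generates the center of $B_3$. The reduced Burau representation $\beta_3:B_3\to \mathrm{GL}_2(\mathbb Z[t^\pm])$ is given by $$\beta_3(\sigma_1)=\begin{pmatrix}-t&1\\0&1\end{pmatrix},\qquad \beta_3(\sigma_2)=\begin{pmatrix}1&0\\t&-t\end{pmatrix}.$$ *)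

theory Defs
  imports "HOL-Analysis.Analysis" "HOL-Algebra.Algebra" "HOL-Library.Poly_Mapping"
begin

section \<open>The braid group on three strands\<close>

text \<open>
  Artin's presentation $\langle s_1, s_2 \mid s_1 s_2 s_1 = s_2 s_1 s_2\rangle$: words in signed
  generators modulo the congruence generated by free cancellation and the braid relation.
  The letter \<open>(g, True)\<close> stands for the generator \<open>g\<close> and \<open>(g, False)\<close> for its inverse.
\<close>

datatype braid_gen = S1 | S2

type_synonym braid_word = "(braid_gen \<times> bool) list"

inductive braid_eq :: "braid_word \<Rightarrow> braid_word \<Rightarrow> bool" where
  refl: "braid_eq u u"
| sym: "braid_eq u v \<Longrightarrow> braid_eq v u"
| trans: "braid_eq u v \<Longrightarrow> braid_eq v w \<Longrightarrow> braid_eq u w"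
| append: "braid_eq u u' \<Longrightarrow> braid_eq v v' \<Longrightarrow> braid_eq (u @ v) (u' @ v')"
| cancel: "braid_eq [(g, b), (g, \<not> b)] []"
| braid: "braid_eq [(S1, True), (S2, True), (S1, True)] [(S2, True), (S1, True), (S2, True)]"

quotient_type braid3 = braid_word / braid_eq
  by (intro equivpI reflpI sympI transpI) (blast intro: braid_eq.intros)+

lift_definition braid_mult :: "braid3 \<Rightarrow> braid3 \<Rightarrow> braid3" is "(@)"
  by (rule braid_eq.append)

lift_definition braid_one :: braid3 is "[]" .

lift_definition half_twist :: "braid_gen \<Rightarrow> braid3" is "\<lambda>g. [(g, True)]" .

definition B3 :: "braid3 monoid" where
  "B3 = \<lparr>carrier = UNIV, mult = braid_mult, one = braid_one\<rparr>"

definition full_twist :: braid3 where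
  "full_twist = (half_twist S1 \<otimes>\<^bsub>B3\<^esub> half_twist S2) [^]\<^bsub>B3\<^esub> (3::nat)"

definition word_inv :: "braid_word \<Rightarrow> braid_word" where
  "word_inv w = rev (map (\<lambda>(g, b). (g, \<not> b)) w)"

lemma word_inv_cancel: "braid_eq (word_inv w @ w) []"
proof (induction w)
  case Nil
  show ?case by (simp add: word_inv_def braid_eq.refl)
next
  case (Cons a w)
  obtain g b where a: "a = (g, b)" by (cases a)
  have "braid_eq [(g, \<not> b), (g, \<not> \<not> b)] []" by (rule braid_eq.cancel)
  then have "braid_eq (word_inv w @ [(g, \<not> b), (g, b)] @ w) (word_inv w @ [] @ w)"
    by (intro braid_eq.append braid_eq.refl) simp
  with Cons.IH show ?case
    by (auto simp: a word_inv_def intro: braid_eq.trans)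
qed

lemma group_B3: "group B3"
proof (rule groupI)
  fix x assume "x \<in> carrier B3"
  have "\<exists>y. braid_mult y x = braid_one"
    by transfer (use word_inv_cancel in blast)
  then show "\<exists>y\<in>carrier B3. y \<otimes>\<^bsub>B3\<^esub> x = \<one>\<^bsub>B3\<^esub>" by (simp add: B3_def)
next
  fix x y z
  show "x \<otimes>\<^bsub>B3\<^esub> y \<otimes>\<^bsub>B3\<^esub> z = x \<otimes>\<^bsub>B3\<^esub> (y \<otimes>\<^bsub>B3\<^esub> z)"
    by (simp add: B3_def) (transfer, simp add: braid_eq.refl)
next
  fix x
  show "\<one>\<^bsub>B3\<^esub> \<otimes>\<^bsub>B3\<^esub> x = x"
    by (simp add: B3_def) (transfer, simp add: braid_eq.refl)
qed (simp_all add: B3_def)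


section \<open>General linear groups\<close>

definition GL :: "('a::comm_ring_1 ^ 'n ^ 'n) monoid" where
  "GL = \<lparr>carrier = {A. invertible A}, mult = (**), one = mat 1\<rparr>"

lemma group_GL: "group (GL :: ('a::comm_ring_1 ^ 'n ^ 'n) monoid)"
proof (rule groupI)
  fix x :: "'a ^ 'n ^ 'n" assume "x \<in> carrier GL"
  then obtain y where "x ** y = mat 1" "y ** x = mat 1"
    by (auto simp: GL_def invertible_def)
  then show "\<exists>y\<in>carrier GL. y \<otimes>\<^bsub>GL\<^esub> x = \<one>\<^bsub>GL\<^esub>"
    by (intro bexI[of _ y]) (auto simp: GL_def invertible_def)
next
  fix x y :: "'a ^ 'n ^ 'n" assume "x \<in> carrier GL" "y \<in> carrier GL"
  then obtain x' y' where *: "x ** x' = mat 1" "x' ** x = mat 1" "y ** y' = mat 1" "y' ** y = mat 1"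
    by (auto simp: GL_def invertible_def)
  have "x ** y ** (y' ** x') = x ** (y ** y') ** x'" "y' ** x' ** (x ** y) = y' ** (x' ** x) ** y"
    by (simp_all add: matrix_mul_assoc)
  with * show "x \<otimes>\<^bsub>GL\<^esub> y \<in> carrier GL"
    by (auto simp: GL_def invertible_def)
qed (auto simp: GL_def matrix_mul_assoc invertible_def)


section \<open>The reduced Burau representation and its specializations\<close>

text \<open>
  The ring $\mathbb{Z}[t^{\pm 1}]$ is the group ring of the additive group of integers, with the
  convolution product of \<open>Poly_Mapping\<close>.
\<close>

type_synonym laurent = "int \<Rightarrow>\<^sub>0 int"

definition t_var :: laurent where
  "t_var = Poly_Mapping.single 1 1"

definition laurent_eval :: "complex \<Rightarrow> laurent \<Rightarrow> complex" where
  "laurent_eval z p = (\<Sum>k\<in>Poly_Mapping.keys p. of_int (Poly_Mapping.lookup p k) * z powi k)"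

fun burau_gen :: "braid_gen \<Rightarrow> laurent ^ 2 ^ 2" where
  "burau_gen S1 = vector [vector [- t_var, 1], vector [0, 1]]"
| "burau_gen S2 = vector [vector [1, 0], vector [t_var, - t_var]]"

fun burau_letter :: "braid_gen \<times> bool \<Rightarrow> laurent ^ 2 ^ 2" where
  "burau_letter (g, b) = (if b then burau_gen g else inv\<^bsub>GL\<^esub> burau_gen g)"

fun burau_word :: "braid_word \<Rightarrow> laurent ^ 2 ^ 2" where
  "burau_word [] = \<one>\<^bsub>GL\<^esub>"
| "burau_word (a # w) = burau_letter a \<otimes>\<^bsub>GL\<^esub> burau_word w"

lemma t_var_inverse: "t_var * Poly_Mapping.single (- 1) 1 = 1"
  by (simp add: t_var_def Poly_Mapping.mult_single)

lemma burau_gen_GL: "burau_gen g \<in> carrier GL"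
proof -
  define s :: laurent where "s = Poly_Mapping.single (- 1) 1"
  have ts: "t_var * s = 1" "s * t_var = 1"
    using t_var_inverse by (simp_all add: s_def mult.commute)
  show ?thesis
  proof (cases g)
    case S1
    let ?A = "vector [vector [- s, s], vector [0, 1]] :: laurent ^ 2 ^ 2"
    have "burau_gen S1 ** ?A = mat 1" "?A ** burau_gen S1 = mat 1"
      by (simp_all add: vec_eq_iff forall_2 matrix_matrix_mult_def sum_2 mat_def ts)
    with S1 show ?thesis by (auto simp: GL_def invertible_def)
  next
    case S2
    let ?A = "vector [vector [1, 0], vector [1, - s]] :: laurent ^ 2 ^ 2"
    have "burau_gen S2 ** ?A = mat 1" "?A ** burau_gen S2 = mat 1"
      by (simp_all add: vec_eq_iff forall_2 matrix_matrix_mult_def sum_2 mat_def ts)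
    with S2 show ?thesis by (auto simp: GL_def invertible_def)
  qed
qed

lemma burau_word_GL: "burau_word w \<in> carrier GL"
proof -
  interpret GL: group "GL :: (laurent ^ 2 ^ 2) monoid" by (rule group_GL)
  show ?thesis
  proof (induction w)
    case (Cons a w)
    then show ?case by (cases a) (simp add: burau_gen_GL)
  qed simp
qed

lemma burau_word_append: "burau_word (u @ v) = burau_word u \<otimes>\<^bsub>GL\<^esub> burau_word v"
proof -
  interpret GL: group "GL :: (laurent ^ 2 ^ 2) monoid" by (rule group_GL)
  show ?thesis
  proof (induction u)
    case Nil
    show ?case by (simp add: burau_word_GL)
  next
    case (Cons a u)
    then show ?case
      by (cases a) (simp add: GL.m_assoc burau_gen_GL burau_word_GL)
  qed
qed

lemma burau_word_cong: "braid_eq u v \<Longrightarrow> burau_word u = burau_word v"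
proof (induction rule: braid_eq.induct)
  case (cancel g b)
  interpret GL: group "GL :: (laurent ^ 2 ^ 2) monoid" by (rule group_GL)
  show ?case by (simp add: burau_gen_GL)
next
  case braid
  interpret GL: group "GL :: (laurent ^ 2 ^ 2) monoid" by (rule group_GL)
  show ?case
    by (simp add: burau_gen_GL del: burau_gen.simps)
       (simp add: GL_def vec_eq_iff forall_2 matrix_matrix_mult_def sum_2)
qed (simp_all add: burau_word_append)

lift_definition burau3 :: "braid3 \<Rightarrow> laurent ^ 2 ^ 2" is burau_word
  by (rule burau_word_cong)

lemma burau3_hom: "burau3 \<in> hom B3 GL"
proof (rule homI)
  fix x
  show "burau3 x \<in> carrier GL" by transfer (rule burau_word_GL)
next
  fix x y
  show "burau3 (x \<otimes>\<^bsub>B3\<^esub> y) = burau3 x \<otimes>\<^bsub>GL\<^esub> burau3 y"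
    by (simp add: B3_def) (transfer, rule burau_word_append)
qed

lemma burau3_half_twist: "burau3 (half_twist g) = burau_gen g"
proof -
  interpret GL: group "GL :: (laurent ^ 2 ^ 2) monoid" by (rule group_GL)
  show ?thesis by transfer (simp add: burau_gen_GL)
qed

definition burau3_at :: "complex \<Rightarrow> braid3 \<Rightarrow> complex ^ 2 ^ 2" where
  "burau3_at z x = map_matrix (laurent_eval z) (burau3 x)"

lemma laurent_eval_single: "laurent_eval z (Poly_Mapping.single k c) = of_int c * z powi k"
  by (cases "c = 0") (simp_all add: laurent_eval_def)

lemma laurent_eval_zero: "laurent_eval z 0 = 0"
  by (simp add: laurent_eval_def)

lemma laurent_eval_one: "laurent_eval z 1 = 1"
  using laurent_eval_single[of z 0 1] by simp

lemma laurent_eval_add: "laurent_eval z (p + r) = laurent_eval z p + laurent_eval z r"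
  unfolding laurent_eval_def
  by (rule Poly_Mapping.setsum_keys_plus_distrib) (simp_all add: algebra_simps)

lemma laurent_induct [case_names single add]:
  fixes p :: laurent
  assumes single: "\<And>k c. P (Poly_Mapping.single k c)"
    and add: "\<And>p r. P p \<Longrightarrow> P r \<Longrightarrow> P (p + r)"
  shows "P p"
proof (induction p rule: Poly_Mapping.update_induct)
  case const
  show ?case using single[of 0 0] by simp
next
  case (update f a b)
  have "Poly_Mapping.update a b f = f + Poly_Mapping.single a b"
    using update(1)
    by (intro poly_mapping_eqI) (auto simp: lookup_update lookup_add lookup_single in_keys_iff when_def)
  with update(3) single add show ?case by simp
qed

lemma laurent_eval_mult:
  assumes "z \<noteq> 0"
  shows "laurent_eval z (p * r) = laurent_eval z p * laurent_eval z r"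
proof (induction p rule: laurent_induct)
  case (single k c)
  show ?case
    by (induction r rule: laurent_induct)
       (simp_all add: Poly_Mapping.mult_single laurent_eval_single laurent_eval_add
          power_int_add assms distrib_left)
qed (simp add: distrib_right laurent_eval_add)

lemma burau3_at_hom:
  assumes "z \<noteq> 0"
  shows "burau3_at z \<in> hom B3 GL"
proof -
  let ?M = "map_matrix (laurent_eval z) :: laurent ^ 2 ^ 2 \<Rightarrow> complex ^ 2 ^ 2"
  have mult: "?M (A ** B) = ?M A ** ?M B" for A B
    by (simp add: vec_eq_iff matrix_matrix_mult_def sum_2 laurent_eval_add laurent_eval_mult assms)
  have one: "?M (mat 1) = mat 1"
    by (simp add: vec_eq_iff mat_def laurent_eval_one laurent_eval_zero)
  have GL: "?M A \<in> carrier GL" if "A \<in> carrier GL" for A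
    using that mult one by (auto simp: GL_def invertible_def) metis
  show ?thesis
  proof (rule homI)
    fix x assume "x \<in> carrier B3"
    then show "burau3_at z x \<in> carrier GL"
      unfolding burau3_at_def by (intro GL hom_in_carrier[OF burau3_hom])
  next
    fix x y assume "x \<in> carrier B3" "y \<in> carrier B3"
    then show "burau3_at z (x \<otimes>\<^bsub>B3\<^esub> y) = burau3_at z x \<otimes>\<^bsub>GL\<^esub> burau3_at z y"
      using mult by (simp add: burau3_at_def hom_mult[OF burau3_hom]) (simp add: GL_def)
  qed
qed


section \<open>Normal closures and roots of unity\<close>

definition normal_closure :: "('a, 'b) monoid_scheme \<Rightarrow> 'a set \<Rightarrow> 'a set" where
  "normal_closure G S = \<Inter> {N. N \<lhd> G \<and> S \<subseteq> N}"

definition primitive_root_of_unity :: "nat \<Rightarrow> complex \<Rightarrow> bool" where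
  "primitive_root_of_unity d q \<longleftrightarrow> d > 0 \<and> q ^ d = 1 \<and> (\<forall>k. 0 < k \<and> k < d \<longrightarrow> q ^ k \<noteq> 1)"

definition complex_units :: "complex monoid" where
  "complex_units = \<lparr>carrier = {z. z \<noteq> 0}, mult = (*), one = 1\<rparr>"

lemma group_complex_units: "group complex_units"
proof (rule groupI)
  fix x assume "x \<in> carrier complex_units"
  then show "\<exists>y\<in>carrier complex_units. y \<otimes>\<^bsub>complex_units\<^esub> x = \<one>\<^bsub>complex_units\<^esub>"
    by (intro bexI[of _ "inverse x"]) (auto simp: complex_units_def)
qed (auto simp: complex_units_def)

end

theory Submission
  imports Defs
begin

text \<open>
  Modulo its centre \<open>B\<^sub>3\<close> is the modular group, and adding the relation
  \<open>\<sigma>\<^sup>d = 1\<close> turns it into the triangle group of type \<open>(2, 3, d)\<close>.  For \<open>d \<ge> 7\<close> and \<open>q = exp(2\<pi>i/d)\<close> the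
  Burau matrices at \<open>-q\<close> act on the hyperbolic plane, and they realize this triangle group as the
  rotations of the tessellation by triangles with angles \<open>\<pi>/2\<close>, \<open>\<pi>/3\<close>, \<open>\<pi>/d\<close>.  This action is
  faithful, so a braid in the kernel of the Burau representation is a product of an element of the
  normal closure of \<open>\<sigma>\<^sup>d\<close> with a power of the full twist.  The full twist acts as the scalar
  \<open>(-q)\<^sup>3\<close>, which has order \<open>l\<close>, so that power is a multiple of \<open>l\<close>.

  Faithfulness is proved by Tits' argument for Coxeter groups.  The triangle group is the group of
  even words in three reflections.  Complex conjugation gives antilinear reflections on
  \<open>\<complex>\<^sup>2\<close> that extend the Burau action (\<open>act_mirror\<close>), and three real quadratic forms on \<open>\<complex>\<^sup>2\<close> play the
  role of signed distances to the three mirrors.  Under a reflection the forms change by the rule of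
  the geometric representation of the Coxeter group (\<open>form_reflect\<close>), that is, by the rule of Mozes'
  numbers game.  A vector on which all three forms are positive exists exactly because
  \<open>1/2 + 1/3 + 1/d < 1\<close> (\<open>exists_point_in_chamber\<close>).  Tits' argument then says that a word which brings
  that vector back to the positive chamber is trivial modulo the Coxeter relations
  (\<open>trivial_if_\<Phi>_pos\<close>); here it is run directly on words, with equality of words read off from the
  braid group modulo the normal closure of \<open>\<sigma>\<^sup>d\<close> and the full twist.

  For another primitive root of unity \<open>q\<close> the invariant Hermitian form may be definite, and there is no
  hyperbolic plane.  But the matrix entries are Laurent polynomials with integer coefficients, and such a
  polynomial vanishes at \<open>-q\<close> if and only if it vanishes at \<open>-exp(2\<pi>i/d)\<close>.  This is the irreducibility of
  the cyclotomic polynomials, proved by Landau's argument with large primes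
  (\<open>root_of_unity_conjugate\<close>).
\<close>

section \<open>The numbers game of a Coxeter group\<close>

fun alternating :: "'s \<Rightarrow> 's \<Rightarrow> nat \<Rightarrow> 's list" where
  "alternating s t 0 = []"
| "alternating s t (Suc n) = s # alternating t s n"

lemma alternating_split:
  "k \<le> n \<Longrightarrow> \<exists>r. alternating s t n = alternating s t k @ r"
proof (induction k arbitrary: s t n)
  case (Suc k)
  then obtain n' where n': "n = Suc n'" "k \<le> n'" by (cases n) auto
  from Suc.IH[OF n'(2)] obtain r where "alternating t s n' = alternating t s k @ r" by blast
  then show ?case by (simp add: n'(1))
qed simp

text \<open>
  In a dihedral group only the alternating words can be reduced.
\<close>

lemma two_letter_word_cases:
  assumes "set u \<subseteq> {s, t}" "s \<noteq> t"
  shows "(\<exists>a b c. u = a @ [c, c] @ b) \<or> u = alternating s t (length u) \<or> u = alternating t s (length u)"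
  using assms
proof (induction u)
  case (Cons x u)
  consider "\<exists>a b c. u = a @ [c, c] @ b" | "u = alternating s t (length u)" | "u = alternating t s (length u)"
    using Cons by auto
  then show ?case
  proof cases
    case 1
    then obtain a b c where "x # u = (x # a) @ [c, c] @ b" by auto
    then show ?thesis by blast
  next
    case 2
    show ?thesis
    proof (cases "x = s \<and> u \<noteq> []")
      case True
      with 2 have "x # u = [] @ [s, s] @ tl u" by (cases u) auto
      then show ?thesis by blast
    qed (use 2 Cons.prems in auto)
  next
    case 3
    show ?thesis
    proof (cases "x = t \<and> u \<noteq> []")
      case True
      with 3 have "x # u = [] @ [t, t] @ tl u" by (cases u) auto
      then show ?thesis by blast
    qed (use 3 Cons.prems in auto)
  qed
qed simp

text \<open>
  The setting of Tits' argument, with the Coxeter group hidden in a congruence \<open>\<doteq>\<close> on words: the relation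
  may be coarser than the congruence generated by the Coxeter relations, as long as it keeps
  the parity of the length and the numbers \<open>\<Phi> w s\<close>.  The number \<open>\<Phi> w s\<close> is the signed distance of the
  point \<open>w \<cdot> v\<close> from the mirror of \<open>s\<close>, for a point \<open>v\<close> inside the fundamental chamber.  The rules
  \<open>\<Phi>_same\<close> and \<open>\<Phi>_other\<close> are the numbers game of Mozes; they describe the geometric representation in the
  coordinates given by the simple roots.
\<close>

locale coxeter_game =
  fixes E :: "'s list \<Rightarrow> 's list \<Rightarrow> bool" (infix \<open>\<doteq>\<close> 50)
    and m :: "'s \<Rightarrow> 's \<Rightarrow> nat"
    and \<Phi> :: "'s list \<Rightarrow> 's \<Rightarrow> real"
  assumes equiv: "equivp (\<doteq>)"
    and Cons_cong: "u \<doteq> v \<Longrightarrow> s # u \<doteq> s # v"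
    and parity: "u \<doteq> v \<Longrightarrow> even (length u) = even (length v)"
    and involution: "s # s # w \<doteq> w"
    and m_ge_2: "s \<noteq> t \<Longrightarrow> 2 \<le> m s t"
    and m_sym: "m s t = m t s"
    and braid: "s \<noteq> t \<Longrightarrow> alternating s t (m s t) @ w \<doteq> alternating t s (m s t) @ w"
    and \<Phi>_cong: "u \<doteq> v \<Longrightarrow> \<Phi> u = \<Phi> v"
    and \<Phi>_same: "\<Phi> (s # w) s = - \<Phi> w s"
    and \<Phi>_other: "s \<noteq> t \<Longrightarrow> \<Phi> (t # w) s = \<Phi> w s + 2 * cos (pi / m s t) * \<Phi> w t"
    and \<Phi>_Nil: "0 < \<Phi> [] s"
begin

lemma E_refl: "u \<doteq> u" and E_sym: "u \<doteq> v \<Longrightarrow> v \<doteq> u"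
  and E_trans [trans]: "u \<doteq> v \<Longrightarrow> v \<doteq> w \<Longrightarrow> u \<doteq> w"
  using equiv by (auto intro: equivp_reflp equivp_symp equivp_transp)

lemma append_cong: "u \<doteq> v \<Longrightarrow> x @ u \<doteq> x @ v"
  by (induction x) (auto intro: Cons_cong)

definition len :: "'s list \<Rightarrow> nat" where
  "len w = (LEAST n. \<exists>v. w \<doteq> v \<and> length v = n)"

lemma len_le: "w \<doteq> v \<Longrightarrow> len w \<le> length v"
  unfolding len_def by (rule Least_le) blast

lemma reduced_word: obtains v where "w \<doteq> v" "length v = len w"
proof -
  have "\<exists>v. w \<doteq> v \<and> length v = len w"
    unfolding len_def by (rule LeastI_ex) (use E_refl in blast)
  then show thesis using that by blast
qed

lemma len_cong: "u \<doteq> v \<Longrightarrow> len u = len v"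
  by (metis E_sym E_trans dual_order.antisym len_le reduced_word)

text \<open>
  This is where parity enters: a reflection either lengthens or shortens a word, so that
  descents and ascents are complementary.
\<close>

lemma len_Cons_neq: "len (s # w) \<noteq> len w"
proof -
  obtain u v where u: "s # w \<doteq> u" "length u = len (s # w)" and v: "w \<doteq> v" "length v = len w"
    by (meson reduced_word)
  show ?thesis using parity[OF u(1)] parity[OF v(1)] u(2) v(2) by auto
qed

text \<open>
  The rank two case can be computed: the vectors \<open>(\<Phi> w s, \<Phi> w t)\<close> obey a linear recurrence whose
  solutions are the sines of the multiples of \<open>\<pi> / m s t\<close>.  The roles of \<open>s\<close> and \<open>t\<close> alternate with the
  parity of \<open>n\<close>, since consing a letter exchanges them.
\<close>

lemma dihedral_expansion:
  fixes \<theta> :: real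
  assumes "s \<noteq> t" and "\<theta> = pi / m s t"
  shows "sin \<theta> * \<Phi> (alternating t s n @ v) s
    = sin (Suc n * \<theta>) * \<Phi> v (if even n then s else t) + sin (n * \<theta>) * \<Phi> v (if even n then t else s)"
  using assms
proof (induction n arbitrary: s t rule: induct_nat_012)
  case 0
  then show ?case by simp
next
  case 1
  then show ?case using sin_double[of \<theta>] by (simp add: \<Phi>_other algebra_simps)
next
  case (ge2 n)
  let ?x = "s # alternating t s n @ v"
  have rec: "\<Phi> (t # ?x) s = - \<Phi> (alternating t s n @ v) s + 2 * cos \<theta> * \<Phi> ?x t"
    using \<Phi>_other[OF ge2.prems(1), of ?x] ge2.prems(2) \<Phi>_same[of s] by simp
  have IH1: "sin \<theta> * \<Phi> (alternating t s n @ v) s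
    = sin (Suc n * \<theta>) * \<Phi> v (if even n then s else t) + sin (n * \<theta>) * \<Phi> v (if even n then t else s)"
    using ge2 by blast
  have IH2: "sin \<theta> * \<Phi> ?x t
    = sin (Suc (Suc n) * \<theta>) * \<Phi> v (if even (Suc n) then t else s)
      + sin (Suc n * \<theta>) * \<Phi> v (if even (Suc n) then s else t)"
    using ge2.IH(2)[of t s] ge2.prems m_sym[of s t] by simp
  have sin_rec: "sin (Suc (Suc k) * \<theta>) = 2 * cos \<theta> * sin (Suc k * \<theta>) - sin (k * \<theta>)" for k :: nat
  proof -
    have "sin (Suc k * \<theta> + \<theta>) + sin (Suc k * \<theta> - \<theta>) = 2 * cos \<theta> * sin (Suc k * \<theta>)"
      by (simp add: sin_add sin_diff)
    then show ?thesis by (simp add: algebra_simps)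
  qed
  define a b where "a = sin (Suc n * \<theta>)" and "b = sin (n * \<theta>)"
  have "sin \<theta> * \<Phi> (alternating t s (Suc (Suc n)) @ v) s
      = - (sin \<theta> * \<Phi> (alternating t s n @ v) s) + 2 * cos \<theta> * (sin \<theta> * \<Phi> ?x t)"
    by (simp add: rec algebra_simps)
  also have "\<dots> = sin (Suc (Suc (Suc n)) * \<theta>) * \<Phi> v (if even n then s else t)
     + sin (Suc (Suc n) * \<theta>) * \<Phi> v (if even n then t else s)"
    unfolding IH1 IH2 sin_rec[of "Suc n"] sin_rec[of n] a_def[symmetric] b_def[symmetric]
    by (cases "even n") (simp_all add: algebra_simps)
  finally show ?case by simp
qed

text \<open>
  All sines in the expansion are nonnegative as long as \<open>n < m s t\<close>: the angle has not passed \<open>\<pi>\<close>.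
\<close>

lemma dihedral_nonneg:
  assumes st: "s \<noteq> t" and n: "n < m s t" and "0 \<le> \<Phi> v s" "0 \<le> \<Phi> v t"
  shows "0 \<le> \<Phi> (alternating t s n @ v) s"
proof -
  define \<theta> where "\<theta> = pi / m s t"
  have m2: "2 \<le> m s t" using m_ge_2[OF st] .
  have nonneg: "0 \<le> sin (k * \<theta>)" if "k \<le> m s t" for k :: nat
    using that m2 by (intro sin_ge_zero) (auto simp: \<theta>_def field_simps)
  have "0 < sin \<theta>"
    using m2 by (intro sin_gt_zero) (auto simp: \<theta>_def field_simps)
  moreover have "0 \<le> sin \<theta> * \<Phi> (alternating t s n @ v) s"
    unfolding dihedral_expansion[OF st \<theta>_def]
    by (intro add_nonneg_nonneg mult_nonneg_nonneg nonneg) (use assms in auto)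
  ultimately show ?thesis by (simp add: zero_le_mult_iff)
qed

text \<open>
  Tits' lemma: if \<open>s\<close> lengthens \<open>w\<close>, then the chamber of \<open>w\<close> lies on the positive side of the mirror of \<open>s\<close>.
  The induction strips from \<open>w\<close> a maximal prefix \<open>u\<close> in the dihedral subgroup generated by \<open>s\<close> and
  a descent \<open>t\<close> of \<open>w\<close>.  Both \<open>s\<close> and \<open>t\<close> lengthen the remaining word \<open>v\<close>, so the induction hypothesis
  applies to it twice, and the dihedral computation transports positivity from \<open>v\<close> to \<open>w\<close>.
\<close>

lemma \<Phi>_nonneg_if_ascent:
  "len w < len (s # w) \<Longrightarrow> 0 \<le> \<Phi> w s"
proof (induction "len w" arbitrary: w s rule: less_induct)
  case less
  show ?case
  proof (cases "w \<doteq> []")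
    case True
    then show ?thesis using \<Phi>_cong[OF True] \<Phi>_Nil[of s] by simp
  next
    case False
    have no_start: False if "w \<doteq> s # y" "length y < len w" for y
    proof -
      have "s # w \<doteq> y" using Cons_cong[OF that(1)] involution E_trans by blast
      then show False using len_le[of "s # w" y] that less.prems by simp
    qed
    obtain t x where tx: "w \<doteq> t # x" "Suc (length x) = len w"
      using False by (metis reduced_word length_Suc_conv neq_Nil_conv length_Cons)
    have st: "s \<noteq> t" using no_start[of x] tx by auto
    define P where "P u v \<longleftrightarrow> set u \<subseteq> {s, t} \<and> w \<doteq> u @ v \<and> length u + length v = len w" for u v
    have Px: "P [t] x" using tx by (simp add: P_def)
    \<comment> \<open>A reduced factorization with the shortest possible second factor: \<open>v\<close> is then the minimal
      coset representative of the dihedral subgroup.\<close>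
    obtain u v where uv: "P u v" and least: "\<And>u' v'. P u' v' \<Longrightarrow> length v \<le> length v'"
    proof -
      define k where "k = (LEAST k. \<exists>u v. P u v \<and> length v = k)"
      have "\<exists>u v. P u v \<and> length v = k"
        unfolding k_def by (rule LeastI_ex) (use Px in blast)
      moreover have "k \<le> length v'" if "P u' v'" for u' v'
        unfolding k_def by (rule Least_le) (use that in blast)
      ultimately show thesis using that by metis
    qed
    have w: "w \<doteq> u @ v" and len: "length u + length v = len w" and set: "set u \<subseteq> {s, t}"
      using uv by (auto simp: P_def)
    have len_v: "len v = length v"
    proof (rule antisym)
      obtain v' where v': "v \<doteq> v'" "length v' = len v" by (rule reduced_word)
      have "w \<doteq> u @ v'" using w append_cong[OF v'(1)] E_trans by blast
      from len_le[OF this] show "length v \<le> len v" using len v'(2) by simp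
    qed (rule len_le[OF E_refl])
    have ascent: "len v < len (r # v)" if "r \<in> {s, t}" for r
    proof (rule ccontr)
      assume "\<not> len v < len (r # v)"
      then have less: "len (r # v) < len v" using len_Cons_neq[of r v] by simp
      obtain v' where v': "r # v \<doteq> v'" "length v' = len (r # v)" by (rule reduced_word)
      have "v \<doteq> r # v'" using Cons_cong[OF v'(1), of r] involution E_sym E_trans by blast
      then have *: "w \<doteq> (u @ [r]) @ v'" using w append_cong[of v "r # v'" u] E_trans by auto
      have "P (u @ [r]) v'"
        using len_le[OF *] * less v'(2) len len_v set that by (auto simp: P_def)
      from least[OF this] show False using less v'(2) len_v by simp
    qed
    have "length v < len w" using least[OF Px] tx(2) by simp
    then have nonneg: "0 \<le> \<Phi> v s" "0 \<le> \<Phi> v t"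
      using less.hyps[of v] ascent len_v by simp_all
    have "\<not> (\<exists>a b c. u = a @ [c, c] @ b)"
    proof
      assume "\<exists>a b c. u = a @ [c, c] @ b"
      then obtain a b c where u: "u = a @ [c, c] @ b" by blast
      have "w \<doteq> a @ b @ v"
        using w append_cong[OF involution[of c "b @ v"], of a] E_trans unfolding u by auto
      from len_le[OF this] show False using len u by simp
    qed
    moreover have "u = []" if "u = alternating s t (length u)"
      using that no_start[of "tl u @ v"] w len by (cases u) auto
    ultimately have u: "u = alternating t s (length u)"
      using two_letter_word_cases[OF set st] by auto
    \<comment> \<open>Otherwise the braid relation would produce a reduced word for \<open>w\<close> that starts with \<open>s\<close>.\<close>
    have "length u < m s t"
    proof (rule ccontr)
      assume "\<not> length u < m s t"
      then obtain r where r: "alternating t s (length u) = alternating t s (m s t) @ r"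
        using alternating_split[of "m s t" "length u" t s] by auto
      obtain k where k: "m s t = Suc k" using m_ge_2[OF st] by (cases "m s t") auto
      let ?y = "alternating t s k @ r @ v"
      have "w \<doteq> alternating s t (m s t) @ r @ v"
        using w u r E_trans[OF _ E_sym[OF braid[OF st, of "r @ v"]]] by simp
      moreover have "length (alternating t s (m s t) @ r) = length u" using u r by metis
      moreover have "length (alternating a b n) = n" for a b :: 's and n
        by (induction n arbitrary: a b) auto
      ultimately show False using no_start[of ?y] k len by simp
    qed
    then show ?thesis
      using dihedral_nonneg[OF st _ nonneg] \<Phi>_cong[OF w] u by metis
  qed
qed

text \<open>
  A nontrivial word has a first letter \<open>s\<close> in a reduced form, and \<open>s\<close> then separates its chamber from the
  fundamental one.
\<close>

theorem trivial_if_\<Phi>_pos: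
  assumes pos: "\<And>s. 0 < \<Phi> w s"
  shows "w \<doteq> []"
proof (rule ccontr)
  assume nontriv: "\<not> w \<doteq> []"
  obtain v where v: "w \<doteq> v" "length v = len w" by (rule reduced_word)
  then obtain s u where su: "v = s # u" using nontriv by (cases v) auto
  have "s # w \<doteq> u" using Cons_cong[OF v(1), of s] involution[of s u] su E_trans by auto
  then have "len (s # w) < len (s # s # w)"
    using len_le[of "s # w" u] len_cong[OF involution[of s w]] v(2) su by simp
  then have "0 \<le> \<Phi> (s # w) s" by (rule \<Phi>_nonneg_if_ascent)
  then show False using pos[of s] by (simp add: \<Phi>_same)
qed

end

section \<open>Galois conjugates of roots of unity\<close>

definition eval_int :: "int poly \<Rightarrow> complex \<Rightarrow> complex" where
  "eval_int p z = poly (map_poly of_int p) z"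

lemma eval_int_simps [simp]:
  "eval_int 0 z = 0"
  "eval_int (pCons a p) z = of_int a + z * eval_int p z"
  by (simp_all add: eval_int_def map_poly_pCons)

lemma eval_int_add [simp]: "eval_int (p + r) z = eval_int p z + eval_int r z"
proof -
  have "map_poly of_int (p + r) = (map_poly of_int p + map_poly of_int r :: complex poly)"
    by (intro poly_eqI) (simp add: coeff_map_poly)
  then show ?thesis by (simp add: eval_int_def)
qed

lemma eval_int_smult [simp]: "eval_int (Polynomial.smult c p) z = of_int c * eval_int p z"
  by (induction p) (simp_all add: algebra_simps)

lemma eval_int_mult [simp]: "eval_int (p * r) z = eval_int p z * eval_int r z"
  by (induction p) (simp_all add: algebra_simps)

lemma eval_int_diff [simp]: "eval_int (p - r) z = eval_int p z - eval_int r z"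
  using eval_int_add[of "p - r" r z] by simp

lemma eval_int_one [simp]: "eval_int 1 z = 1"
  by (simp add: one_pCons)

lemma eval_int_power [simp]: "eval_int (p ^ n) z = eval_int p z ^ n"
  by (induction n) simp_all

lemma eval_int_monom [simp]: "eval_int (Polynomial.monom c n) z = of_int c * z ^ n"
  by (induction n) (simp_all add: monom_0 monom_Suc)

lemma eval_int_pcompose [simp]: "eval_int (Polynomial.pcompose p r) z = eval_int p (eval_int r z)"
  by (induction p) (simp_all add: pcompose_pCons)

text \<open>
  The freshman's dream in a form that keeps the multiple of \<open>p\<close>: characteristic zero is needed
  later, so the congruence cannot be replaced by an equation in characteristic \<open>p\<close>.
\<close>

lemma prime_power_add_mod:
  fixes a b :: "'a :: comm_ring_1"
  assumes "Factorial_Ring.prime p"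
  shows "\<exists>c. (a + b) ^ p = a ^ p + b ^ p + of_nat p * c"
proof -
  have p: "p > 0" using assms prime_gt_0_nat by blast
  have "(a + b) ^ p = (\<Sum>k\<le>p. of_nat (p choose k) * a ^ k * b ^ (p - k))"
    by (rule binomial_ring)
  also have "{..p} = insert 0 (insert p {0<..<p})" using p by auto
  also have "(\<Sum>k\<in>\<dots>. of_nat (p choose k) * a ^ k * b ^ (p - k))
      = a ^ p + b ^ p + (\<Sum>k\<in>{0<..<p}. of_nat (p choose k) * a ^ k * b ^ (p - k))"
    using p by (simp add: algebra_simps)
  also have "(\<Sum>k\<in>{0<..<p}. of_nat (p choose k) * a ^ k * b ^ (p - k))
      = (\<Sum>k\<in>{0<..<p}. of_nat p * (of_nat ((p choose k) div p) * a ^ k * b ^ (p - k)))"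
  proof (rule sum.cong[OF HOL.refl])
    fix k assume "k \<in> {0<..<p}"
    then have "p dvd (p choose k)" using assms by (intro dvd_choose_prime) auto
    then have "p choose k = p * ((p choose k) div p)" by simp
    then have "(of_nat (p choose k) :: 'a) = of_nat p * of_nat ((p choose k) div p)"
      by (metis of_nat_mult)
    then show "of_nat (p choose k) * a ^ k * b ^ (p - k)
      = of_nat p * (of_nat ((p choose k) div p) * a ^ k * b ^ (p - k))" by (simp add: mult.assoc)
  qed
  finally show ?thesis by (auto simp flip: sum_distrib_left)
qed

lemma int_fermat:
  assumes "Factorial_Ring.prime p"
  shows "\<exists>c::int. a ^ p = a + int p * c"
proof -
  have p: "p > 0" using assms prime_gt_0_nat by blast
  show ?thesis
  proof (induction a rule: int_induct[of _ 0])
    case base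
    show ?case using p by (intro exI[of _ 0]) (simp add: zero_power)
  next
    case (step1 i)
    then obtain c where "i ^ p = i + int p * c" by blast
    moreover obtain c' where "(i + 1) ^ p = i ^ p + 1 ^ p + int p * c'"
      using prime_power_add_mod[OF assms, of i 1] by auto
    ultimately have "(i + 1) ^ p = (i + 1) + int p * (c + c')" by (simp add: algebra_simps)
    then show ?case by blast
  next
    case (step2 i)
    then obtain c where "i ^ p = i + int p * c" by blast
    moreover obtain c' where "(i - 1 + 1) ^ p = (i - 1) ^ p + 1 ^ p + int p * c'"
      using prime_power_add_mod[OF assms, of "i - 1" 1] by auto
    ultimately have "(i - 1) ^ p = (i - 1) + int p * (c - c')" by (simp add: algebra_simps)
    then show ?case by blast
  qed
qed

text \<open>
  The congruence \<open>f(x\<^sup>p) \<equiv> f(x)\<^sup>p\<close> modulo \<open>p\<close> for an integer polynomial \<open>f\<close>.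
\<close>

lemma poly_frobenius_mod_prime:
  assumes "Factorial_Ring.prime p"
  shows "\<exists>r. \<forall>z. eval_int f (z ^ p) = eval_int f z ^ p + of_nat p * eval_int r z"
proof (induction f)
  case 0
  have "p > 0" using assms prime_gt_0_nat by blast
  then show ?case by (intro exI[of _ 0]) simp
next
  case (pCons a f)
  then obtain r where r: "\<And>z. eval_int f (z ^ p) = eval_int f z ^ p + of_nat p * eval_int r z" by blast
  obtain c where c: "a ^ p = a + int p * c" using int_fermat[OF assms] by blast
  obtain s where s: "([:a:] + [:0, 1:] * f) ^ p = [:a:] ^ p + ([:0, 1:] * f) ^ p + of_nat p * s"
    using prime_power_add_mod[OF assms] by blast
  have p_eval: "eval_int (of_nat n) z = of_nat n" for n z by (simp add: of_nat_poly)
  have "eval_int (pCons a f) (z ^ p)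
    = eval_int (pCons a f) z ^ p + of_nat p * eval_int ([:0, 1:] ^ p * r - [:c:] - s) z" for z
  proof -
    have "eval_int (pCons a f) z ^ p = eval_int (([:a:] + [:0, 1:] * f) ^ p) z" by simp
    also have "\<dots> = of_int (a ^ p) + z ^ p * eval_int f z ^ p + of_nat p * eval_int s z"
      unfolding s by (simp add: p_eval power_mult_distrib)
    finally have "eval_int (pCons a f) z ^ p
      = of_int (a + int p * c) + z ^ p * eval_int f z ^ p + of_nat p * eval_int s z"
      unfolding c .
    then show ?thesis by (simp add: r algebra_simps)
  qed
  then show ?case by blast
qed

text \<open>
  A nonzero element of \<open>\<int>[\<zeta>]\<close> is divisible by only finitely many primes.  Take an integer polynomial
  \<open>f\<close> of least degree that vanishes at \<open>\<zeta>\<close>, with leading coefficient \<open>c\<close>.  Up to a power of \<open>c\<close>, every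
  element of \<open>\<int>[\<zeta>]\<close> is \<open>r(\<zeta>)\<close> with \<open>degree r < degree f\<close>, and this \<open>r\<close> is unique; hence a prime that
  divides the element and exceeds \<open>\<bar>c\<bar>\<close> divides the coefficients of \<open>r\<close>.
\<close>

lemma bounded_prime_divisors:
  assumes root: "f \<noteq> 0" "eval_int f \<zeta> = 0" and nz: "eval_int g \<zeta> \<noteq> 0"
  shows "\<exists>A. \<forall>p r. Factorial_Ring.prime p \<and> p > A \<longrightarrow> eval_int g \<zeta> \<noteq> of_nat p * eval_int r \<zeta>"
proof -
  obtain f where f: "f \<noteq> 0" "eval_int f \<zeta> = 0"
    and least: "\<And>h. h \<noteq> 0 \<Longrightarrow> eval_int h \<zeta> = 0 \<Longrightarrow> Polynomial.degree f \<le> Polynomial.degree h"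
  proof -
    have "\<exists>f. (f \<noteq> 0 \<and> eval_int f \<zeta> = 0) \<and> (\<forall>h. h \<noteq> 0 \<and> eval_int h \<zeta> = 0 \<longrightarrow> Polynomial.degree f \<le> Polynomial.degree h)"
      using ex_has_least_nat[of "\<lambda>f. f \<noteq> 0 \<and> eval_int f \<zeta> = 0" f Polynomial.degree] root by blast
    then show thesis using that by blast
  qed
  define c where "c = Polynomial.lead_coeff f"
  have reduce: "\<exists>k r. (r = 0 \<or> Polynomial.degree r < Polynomial.degree f) \<and> of_int c ^ k * eval_int h \<zeta> = eval_int r \<zeta>" for h
  proof -
    obtain q r where qr: "pseudo_divmod h f = (q, r)" by (cases "pseudo_divmod h f")
    let ?k = "Suc (Polynomial.degree h) - Polynomial.degree f"
    have *: "Polynomial.smult (c ^ ?k) h = f * q + r" "r = 0 \<or> Polynomial.degree r < Polynomial.degree f"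
      using pseudo_divmod[OF f(1) qr] by (simp_all add: c_def)
    have "of_int c ^ ?k * eval_int h \<zeta> = eval_int (Polynomial.smult (c ^ ?k) h) \<zeta>" by simp
    also have "\<dots> = eval_int r \<zeta>" unfolding *(1) using f(2) by simp
    finally show ?thesis using *(2) by blast
  qed
  have c0: "c \<noteq> 0" using f by (simp add: c_def)
  obtain j s where s: "s = 0 \<or> Polynomial.degree s < Polynomial.degree f" "of_int c ^ j * eval_int g \<zeta> = eval_int s \<zeta>"
    using reduce by blast
  have "eval_int s \<zeta> \<noteq> 0" using s(2) nz c0 by (metis mult_eq_0_iff of_int_eq_0_iff power_not_zero)
  then have "s \<noteq> 0" by auto
  then obtain i where i: "Polynomial.coeff s i \<noteq> 0" by (metis leading_coeff_0_iff)
  define A where "A = nat (\<bar>c\<bar> + \<bar>Polynomial.coeff s i\<bar>)"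
  have "eval_int g \<zeta> \<noteq> of_nat p * eval_int r \<zeta>" if p: "Factorial_Ring.prime p" "p > A" for p r
  proof
    assume eq: "eval_int g \<zeta> = of_nat p * eval_int r \<zeta>"
    obtain k u where u: "u = 0 \<or> Polynomial.degree u < Polynomial.degree f" "of_int c ^ k * eval_int r \<zeta> = eval_int u \<zeta>"
      using reduce by blast
    let ?h = "Polynomial.smult (c ^ k) s - Polynomial.smult (int p * c ^ j) u"
    have "eval_int ?h \<zeta> = of_int c ^ k * (of_int c ^ j * eval_int g \<zeta>)
        - of_nat p * of_int c ^ j * (of_int c ^ k * eval_int r \<zeta>)"
      unfolding s(2) u(2) by simp
    then have h0: "eval_int ?h \<zeta> = 0" by (simp add: eq algebra_simps)
    have "?h = 0"
    proof (rule ccontr)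
      assume "?h \<noteq> 0"
      then have "Polynomial.degree f \<le> Polynomial.degree ?h" using least h0 by blast
      moreover have "Polynomial.degree ?h \<le> max (Polynomial.degree s) (Polynomial.degree u)"
        by (intro order.trans[OF degree_diff_le_max] max.mono degree_smult_le)
      ultimately have "Polynomial.degree f \<le> Polynomial.degree s \<or> Polynomial.degree f \<le> Polynomial.degree u" by linarith
      then have "Polynomial.degree f = 0"
        using s(1) u(1) \<open>s \<noteq> 0\<close> by (auto)
      then have "Polynomial.degree s < 0" using s(1) \<open>s \<noteq> 0\<close> by simp
      then show False by simp
    qed
    then have "Polynomial.smult (c ^ k) s = Polynomial.smult (int p * c ^ j) u" by simp
    then have "c ^ k * Polynomial.coeff s i = int p * c ^ j * Polynomial.coeff u i" by (metis coeff_smult)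
    then have "int p dvd c ^ k * Polynomial.coeff s i" by (simp add: mult.assoc)
    moreover have "Factorial_Ring.prime (int p)" using p by simp
    ultimately have "int p dvd c \<or> int p dvd Polynomial.coeff s i"
      using prime_dvd_mult_iff prime_dvd_power by blast
    moreover have "\<bar>c\<bar> < int p" "\<bar>Polynomial.coeff s i\<bar> < int p" using p(2) by (auto simp: A_def)
    ultimately show False 
      using dvd_imp_le_int[OF c0, of "int p"] dvd_imp_le_int[OF i, of "int p"] by auto
  qed
  then show ?thesis by blast
qed

text \<open>
  Adding \<open>d\<close> times the product of the small primes that do not divide \<open>k\<close> makes the residue class
  representative indivisible by all small primes.
\<close>

lemma coprime_residue_avoiding_small_primes:
  assumes "coprime k (d::nat)"
  shows "\<exists>t. \<forall>p. Factorial_Ring.prime p \<and> p dvd k + d * t \<longrightarrow> p > A"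
proof -
  let ?S = "{p. Factorial_Ring.prime p \<and> p \<le> A \<and> \<not> p dvd k}"
  define t where "t = \<Prod>?S"
  have fin: "finite ?S" by simp
  have "p > A" if p: "Factorial_Ring.prime p" "p dvd k + d * t" for p
  proof (rule ccontr)
    assume "\<not> p > A"
    show False
    proof (cases "p dvd k")
      case True
      then have "p dvd d * t" using p(2) by (simp add: dvd_add_right_iff)
      moreover have "\<not> p dvd d" using True assms p(1) by (meson coprime_common_divisor not_prime_unit)
      ultimately have "p dvd t" using p(1) prime_dvd_mult_iff by blast
      then obtain r where r: "r \<in> ?S" "p dvd r"
        using prime_dvd_prod_iff[OF fin p(1)] unfolding t_def by auto
      then have "p = r" using p(1) primes_dvd_imp_eq by blast
      then show False using r(1) True by simp
    next
      case False
      then have "p \<in> ?S" using p \<open>\<not> p > A\<close> by simp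
      then have "p dvd t" unfolding t_def using fin by (intro dvd_prodI)
      then have "p dvd k" using p(2) by (simp add: dvd_add_left_iff)
      then show False using False by simp
    qed
  qed
  then show ?thesis by blast
qed

text \<open>
  Landau's argument: if \<open>g(z\<^sup>i) = 0\<close>, then \<open>g(z^(i p))\<close> is divisible by \<open>p\<close> in \<open>\<int>[z]\<close>.  Since \<open>z\<close> is a root of
  unity, \<open>g(z^(i p))\<close> takes only finitely many values, so one bound on the prime divisors serves for all
  of them, and for larger \<open>p\<close> the value has to vanish.
\<close>

lemma large_prime_conjugates:
  assumes z: "z ^ d = 1" "d > 0"
  shows "\<exists>A. \<forall>p i. Factorial_Ring.prime p \<and> p > A \<and> eval_int g (z ^ i) = 0 \<longrightarrow> eval_int g (z ^ (i * p)) = 0"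
proof -
  have root: "Polynomial.monom 1 d - 1 \<noteq> (0 :: int poly)" "eval_int (Polynomial.monom 1 d - 1) z = 0"
  proof -
    have "Polynomial.coeff (Polynomial.monom 1 d - 1) d = (1::int)" using z(2) by simp
    then show "Polynomial.monom 1 d - 1 \<noteq> (0 :: int poly)" by (metis coeff_0 zero_neq_one)
  qed (use z in simp)
  define G where "G j = Polynomial.pcompose g (Polynomial.monom 1 j)" for j
  have G: "eval_int (G j) z = eval_int g (z ^ j)" for j by (simp add: G_def)
  have mod: "z ^ n = z ^ (n mod d)" for n
    using z(1) by (metis div_mult_mod_eq mult.commute mult_1 power_add power_mult power_one)
  have "\<exists>B. \<forall>p r. Factorial_Ring.prime p \<and> p > B \<and> eval_int (G j) z \<noteq> 0 \<longrightarrow> eval_int (G j) z \<noteq> of_nat p * eval_int r z" for j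
    using bounded_prime_divisors[OF root, of "G j"] by blast
  then obtain B where B: "\<And>j p r. Factorial_Ring.prime p \<Longrightarrow> p > B j \<Longrightarrow> eval_int (G j) z \<noteq> 0
     \<Longrightarrow> eval_int (G j) z \<noteq> of_nat p * eval_int r z" by metis
  define A where "A = Max (B ` {..<d})"
  have "eval_int g (z ^ (i * p)) = 0" if p: "Factorial_Ring.prime p" "p > A" "eval_int g (z ^ i) = 0" for p i
  proof -
    obtain r where r: "\<And>y. eval_int (G i) (y ^ p) = eval_int (G i) y ^ p + of_nat p * eval_int r y"
      using poly_frobenius_mod_prime[OF p(1)] by blast
    let ?j = "(i * p) mod d"
    have "B ?j \<le> A" unfolding A_def using z(2) by (intro Max_ge) auto
    then have j: "B ?j < p" using p(2) by simp
    have Gj: "eval_int (G ?j) z = eval_int g (z ^ (i * p))" by (simp add: G flip: mod)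
    also have "\<dots> = eval_int (G i) (z ^ p)" by (simp add: G_def mult.commute flip: power_mult)
    also have "\<dots> = of_nat p * eval_int r z"
      using r[of z] p(3) G[of i] prime_gt_0_nat[OF p(1)] by simp
    finally have "eval_int (G ?j) z = 0" using B[OF p(1) j, of r] by blast
    then show ?thesis using Gj by simp
  qed
  then show ?thesis by blast
qed

text \<open>
  Modulo \<open>d\<close> the exponent \<open>k\<close> is a product of large primes, which can be applied one after the other.
\<close>

theorem root_of_unity_conjugate:
  assumes "z ^ d = 1" "d > 0" and k: "coprime k d" and "eval_int g z = 0"
  shows "eval_int g (z ^ k) = 0"
proof -
  obtain A where A: "\<And>p i. Factorial_Ring.prime p \<Longrightarrow> p > A \<Longrightarrow> eval_int g (z ^ i) = 0 \<Longrightarrow> eval_int g (z ^ (i * p)) = 0"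
    using large_prime_conjugates[OF assms(1,2)] by blast
  obtain t where t: "\<And>p. Factorial_Ring.prime p \<Longrightarrow> p dvd k + d * t \<Longrightarrow> p > A"
    using coprime_residue_avoiding_small_primes[OF k, of A] by blast
  have step: "eval_int g (z ^ (i * n)) = 0"
    if "eval_int g (z ^ i) = 0" "\<And>p. Factorial_Ring.prime p \<Longrightarrow> p dvd n \<Longrightarrow> p > A" "n > 0" for n i
    using that
  proof (induction n arbitrary: i rule: prime_divisors_induct)
    case (factor p n)
    have "eval_int g (z ^ (i * p)) = 0"
      using factor.prems factor.hyps A by auto
    moreover have "q > A" if "Factorial_Ring.prime q" "q dvd n" for q using factor.prems(2) that by simp
    ultimately have "eval_int g (z ^ (i * p * n)) = 0" using factor.IH factor.prems(3) by simp
    then show ?case by (simp add: mult.assoc)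
  qed simp_all
  have zk: "z ^ (k + d * t) = z ^ k" by (simp add: power_add power_mult assms)
  show ?thesis
  proof (cases "k + d * t = 0")
    case True
    then show ?thesis using k assms by (auto simp: coprime_iff_gcd_eq_1)
  next
    case False
    then show ?thesis using step[of 1 "k + d * t"] t assms(4) zk by simp
  qed
qed

section \<open>The mirror involution and the centre of the braid group\<close>

lemma carrier_B3 [simp]: "carrier B3 = UNIV"
  by (simp add: B3_def)

interpretation B3: group B3
  by (rule group_B3)

abbreviation braid_times (infixl \<open>\<diamondop>\<close> 70) where "x \<diamondop> y \<equiv> x \<otimes>\<^bsub>B3\<^esub> y"

lemma mult_inv_cancel [simp]:
  "x \<diamondop> (inv\<^bsub>B3\<^esub> x \<diamondop> y) = y" "inv\<^bsub>B3\<^esub> x \<diamondop> (x \<diamondop> y) = y"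
  by (simp_all flip: B3.m_assoc)

lemma normal_closure_normal:
  assumes "group G" "S \<subseteq> carrier G"
  shows "normal_closure G S \<lhd> G"
proof -
  interpret group G by fact
  have "carrier G \<lhd> G" by (simp add: normal_inv_iff subgroup_self)
  then have ne: "{N. N \<lhd> G \<and> S \<subseteq> N} \<noteq> {}" using assms by blast
  have "subgroup (normal_closure G S) G"
    unfolding normal_closure_def by (rule subgroups_Inter) (use ne normal_imp_subgroup in auto)
  then show ?thesis
    by (auto simp: normal_inv_iff normal_closure_def)
qed

lemma generators_in_normal_closure: "S \<subseteq> normal_closure G S"
  by (auto simp: normal_closure_def)

lemma normal_closure_least: "N \<lhd> G \<Longrightarrow> S \<subseteq> N \<Longrightarrow> normal_closure G S \<subseteq> N"
  by (auto simp: normal_closure_def)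

lemma braid_relation:
  "half_twist S1 \<diamondop> half_twist S2 \<diamondop> half_twist S1 = half_twist S2 \<diamondop> half_twist S1 \<diamondop> half_twist S2"
  by (simp add: B3_def) (transfer, simp add: braid_eq.braid)

text \<open>
  The Garside element.  Conjugation by it exchanges the two generators, and its square is the full twist.
\<close>

definition half_turn :: braid3 where
  "half_turn = half_twist S1 \<diamondop> half_twist S2 \<diamondop> half_twist S1"

lemma half_turn_S1: "half_turn \<diamondop> half_twist S1 = half_twist S2 \<diamondop> half_turn"
  unfolding half_turn_def by (subst braid_relation) (simp add: B3.m_assoc)

lemma half_turn_S2: "half_turn \<diamondop> half_twist S2 = half_twist S1 \<diamondop> half_turn"
  unfolding half_turn_def by (subst (2) braid_relation) (simp add: B3.m_assoc)

lemma full_twist_eq: "full_twist = half_turn \<diamondop> half_turn"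
proof -
  have "full_twist = (half_twist S1 \<diamondop> half_twist S2 \<diamondop> half_twist S1)
      \<diamondop> (half_twist S2 \<diamondop> half_twist S1 \<diamondop> half_twist S2)"
    by (simp add: full_twist_def numeral_3_eq_3 B3.m_assoc)
  then show ?thesis by (simp add: half_turn_def flip: braid_relation)
qed

lemma full_twist_half_twist: "full_twist \<diamondop> half_twist g = half_twist g \<diamondop> full_twist"
proof (cases g)
  case S1
  then show ?thesis
    by (metis B3.m_assoc UNIV_I carrier_B3 full_twist_eq half_turn_S1 half_turn_S2)
next
  case S2
  then show ?thesis
    by (metis B3.m_assoc UNIV_I carrier_B3 full_twist_eq half_turn_S1 half_turn_S2)
qed

lemma inv_half_twist: "inv\<^bsub>B3\<^esub> half_twist g = abs_braid3 [(g, False)]"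
proof (rule B3.inv_equality)
  show "abs_braid3 [(g, False)] \<diamondop> half_twist g = \<one>\<^bsub>B3\<^esub>"
    unfolding B3_def half_twist_def
    using braid_eq.cancel[of g False]
    by (simp add: half_twist.abs_eq braid_mult.abs_eq braid_one_def braid3.abs_eq_iff)
qed simp_all

text \<open>
  A braid is a product of generators and their inverses.
\<close>

lemma braid_induct [case_names one twist untwist]:
  assumes "P \<one>\<^bsub>B3\<^esub>"
    and "\<And>g x. P x \<Longrightarrow> P (half_twist g \<diamondop> x)"
    and "\<And>g x. P x \<Longrightarrow> P (inv\<^bsub>B3\<^esub> half_twist g \<diamondop> x)"
  shows "P x"
proof -
  have "P (abs_braid3 w)" for w
  proof (induction w)
    case Nil
    then show ?case using assms(1) by (simp add: B3_def braid_one_def)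
  next
    case (Cons a w)
    obtain g b where a: "a = (g, b)" by (cases a)
    have "abs_braid3 (a # w) = abs_braid3 [a] \<diamondop> abs_braid3 w"
      by (simp add: B3_def braid_mult.abs_eq)
    then show ?case
      using Cons assms(2)[of "abs_braid3 w" g] assms(3)[of "abs_braid3 w" g] a
      by (cases b) (simp_all add: inv_half_twist, simp add: half_twist.abs_eq)
  qed
  then show ?thesis by (metis Quotient3_abs_rep Quotient3_braid3)
qed

lemma inv_commute:
  assumes "f \<diamondop> x = x \<diamondop> f"
  shows "inv\<^bsub>B3\<^esub> f \<diamondop> x = x \<diamondop> inv\<^bsub>B3\<^esub> f"
proof -
  have "inv\<^bsub>B3\<^esub> f \<diamondop> x = inv\<^bsub>B3\<^esub> f \<diamondop> (x \<diamondop> f) \<diamondop> inv\<^bsub>B3\<^esub> f"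
    by (simp add: B3.m_assoc)
  also have "\<dots> = inv\<^bsub>B3\<^esub> f \<diamondop> f \<diamondop> x \<diamondop> inv\<^bsub>B3\<^esub> f"
    by (simp only: assms[symmetric] B3.m_assoc carrier_B3 UNIV_I B3.m_closed B3.inv_closed)
  finally show ?thesis by simp
qed

lemma full_twist_central: "full_twist \<diamondop> x = x \<diamondop> full_twist"
proof (induction x rule: braid_induct)
  case (twist g x)
  then show ?case by (metis B3.m_assoc UNIV_I carrier_B3 full_twist_half_twist)
next
  case (untwist g x)
  have "full_twist \<diamondop> inv\<^bsub>B3\<^esub> half_twist g = inv\<^bsub>B3\<^esub> half_twist g \<diamondop> full_twist"
    using inv_commute[OF full_twist_half_twist[symmetric]] by simp
  with untwist show ?case by (metis B3.m_assoc UNIV_I carrier_B3)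
qed simp

lemma full_twist_pow_central: "full_twist [^]\<^bsub>B3\<^esub> (k::int) \<diamondop> x = x \<diamondop> full_twist [^]\<^bsub>B3\<^esub> k"
proof -
  have nat: "full_twist [^]\<^bsub>B3\<^esub> (n::nat) \<diamondop> x = x \<diamondop> full_twist [^]\<^bsub>B3\<^esub> n" for n
  proof (induction n)
    case (Suc n)
    have "full_twist [^]\<^bsub>B3\<^esub> Suc n \<diamondop> x = (full_twist [^]\<^bsub>B3\<^esub> n \<diamondop> x) \<diamondop> full_twist"
      by (simp add: B3.m_assoc full_twist_central)
    then show ?case by (simp add: Suc B3.m_assoc)
  qed simp
  show ?thesis
    using inv_commute[OF nat] nat by (simp only: int_pow_def2 Let_def split: if_split) simp
qed

lemma word_inv_word_inv: "word_inv (word_inv w) = w"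
  by (simp add: word_inv_def rev_map o_def case_prod_unfold)

lemma braid_eq_word_inv:
  assumes "braid_eq u v"
  shows "braid_eq (word_inv u) (word_inv v)"
proof -
  have "braid_eq (word_inv u @ []) (word_inv u @ v @ word_inv v)"
    using word_inv_cancel[of "word_inv v"]
    by (intro braid_eq.append braid_eq.refl braid_eq.sym[of "v @ word_inv v"]) (simp add: word_inv_word_inv)
  moreover have "braid_eq (word_inv u @ v) []"
    by (rule braid_eq.trans[OF braid_eq.append[OF braid_eq.refl braid_eq.sym[OF assms]] word_inv_cancel])
  then have "braid_eq ((word_inv u @ v) @ word_inv v) ([] @ word_inv v)"
    by (intro braid_eq.append braid_eq.refl)
  ultimately show ?thesis
    using braid_eq.trans by simp
qed

text \<open>
  The automorphism that inverts both generators.  It corresponds to the reflection of the hyperbolic plane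
  in one side of the fundamental triangle, and it makes the triangle group the even part of
  a Coxeter group.
\<close>

lift_definition mirror :: "braid3 \<Rightarrow> braid3" is "map (\<lambda>(g, b). (g, \<not> b))"
proof -
  fix u v :: braid_word assume "braid_eq u v"
  then show "braid_eq (map (\<lambda>(g, b). (g, \<not> b)) u) (map (\<lambda>(g, b). (g, \<not> b)) v)"
  proof (induction rule: braid_eq.induct)
    case (cancel g b)
    show ?case using braid_eq.cancel[of g "\<not> b"] by simp
  next
    case braid
    show ?case using braid_eq_word_inv[OF braid_eq.braid] by (simp add: word_inv_def)
  qed (auto intro: braid_eq.intros)
qed

lemma mirror_mult: "mirror (x \<diamondop> y) = mirror x \<diamondop> mirror y"
  by (simp add: B3_def) (transfer, simp add: braid_eq.refl)

lemma mirror_mirror [simp]: "mirror (mirror x) = x"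
  by transfer (simp add: o_def case_prod_unfold braid_eq.refl)

lemma mirror_half_twist: "mirror (half_twist g) = inv\<^bsub>B3\<^esub> half_twist g"
  unfolding inv_half_twist by transfer (simp add: braid_eq.refl)

lemma mirror_hom: "group_hom B3 B3 mirror"
  by unfold_locales (simp add: hom_def mirror_mult)

interpretation mirror: group_hom B3 B3 mirror by (rule mirror_hom)

lemma mirror_half_turn: "mirror half_turn = inv\<^bsub>B3\<^esub> half_turn"
  by (simp add: half_turn_def mirror_mult mirror_half_twist B3.inv_mult_group B3.m_assoc)

lemma mirror_full_twist: "mirror full_twist = inv\<^bsub>B3\<^esub> full_twist"
  by (simp add: full_twist_eq mirror_mult mirror_half_turn B3.inv_mult_group)

lemma normal_closure_half_twist_pow:
  "normal_closure B3 {half_twist g [^]\<^bsub>B3\<^esub> (d::nat)} = normal_closure B3 {half_twist h [^]\<^bsub>B3\<^esub> d}"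
proof -
  have conj: "half_turn \<diamondop> half_twist a [^]\<^bsub>B3\<^esub> d \<diamondop> inv\<^bsub>B3\<^esub> half_turn = half_twist b [^]\<^bsub>B3\<^esub> d"
    if "a \<noteq> b" for a b
  proof -
    have swap: "half_turn \<diamondop> half_twist a = half_twist b \<diamondop> half_turn"
      using that half_turn_S1 half_turn_S2 by (cases a; cases b) auto
    have "half_turn \<diamondop> half_twist a [^]\<^bsub>B3\<^esub> n = half_twist b [^]\<^bsub>B3\<^esub> n \<diamondop> half_turn" for n :: nat
    proof (induction n)
      case (Suc n)
      have "half_turn \<diamondop> half_twist a [^]\<^bsub>B3\<^esub> Suc n
          = (half_turn \<diamondop> half_twist a [^]\<^bsub>B3\<^esub> n) \<diamondop> half_twist a"
        by (simp add: B3.m_assoc)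
      then show ?case by (simp add: Suc B3.m_assoc swap)
    qed simp
    then show ?thesis by (simp add: B3.m_assoc)
  qed
  have "normal_closure B3 {half_twist b [^]\<^bsub>B3\<^esub> d} \<subseteq> normal_closure B3 {half_twist a [^]\<^bsub>B3\<^esub> d}" for a b
  proof (cases "a = b")
    case False
    interpret N: normal "normal_closure B3 {half_twist a [^]\<^bsub>B3\<^esub> d}" B3
      by (rule normal_closure_normal) (simp_all add: group_B3)
    show ?thesis
    proof (rule normal_closure_least)
      show "{half_twist b [^]\<^bsub>B3\<^esub> d} \<subseteq> normal_closure B3 {half_twist a [^]\<^bsub>B3\<^esub> d}"
        using N.inv_op_closed2[of half_turn "half_twist a [^]\<^bsub>B3\<^esub> d"] conj[OF False]
          generators_in_normal_closure[of "{half_twist a [^]\<^bsub>B3\<^esub> d}" B3] by auto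
    qed (rule N.normal_axioms)
  qed simp
  then show ?thesis by blast
qed

text \<open>
  For either generator in place of \<open>S1\<close> this is the same subgroup, by the preceding lemma.
\<close>

definition twist_powers :: "nat \<Rightarrow> braid3 set" where
  "twist_powers d = normal_closure B3 {half_twist S1 [^]\<^bsub>B3\<^esub> d}"

lemma twist_powers_normal: "twist_powers d \<lhd> B3"
  unfolding twist_powers_def by (rule normal_closure_normal) (simp_all add: group_B3)

text \<open>
  The preimage of the normal closure under the mirror automorphism is normal and contains
  \<open>\<sigma>\<^sup>d\<close>, since its image \<open>\<sigma>^(-d)\<close> lies in the normal closure.
\<close>

lemma mirror_twist_powers:
  assumes "x \<in> twist_powers d"
  shows "mirror x \<in> twist_powers d"
proof -
  interpret N: normal "twist_powers d" B3 by (rule twist_powers_normal)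
  let ?N = "{x. mirror x \<in> twist_powers d}"
  have "?N \<lhd> B3"
    unfolding B3.normal_inv_iff
  proof (intro conjI ballI)
    show "subgroup ?N B3"
      by unfold_locales (auto simp: mirror_mult)
  qed (auto simp: mirror_mult N.inv_op_closed2)
  moreover have "half_twist S1 [^]\<^bsub>B3\<^esub> d \<in> ?N"
    using generators_in_normal_closure[of "{half_twist S1 [^]\<^bsub>B3\<^esub> d}" B3]
    by (auto simp: mirror.hom_nat_pow mirror_half_twist B3.nat_pow_inv simp flip: twist_powers_def)
  ultimately have "twist_powers d \<subseteq> ?N"
    unfolding twist_powers_def by (intro normal_closure_least) auto
  with assms show ?thesis by auto
qed

text \<open>
  The kernel of the map from \<open>B\<^sub>3\<close> onto the triangle group of type \<open>(2, 3, d)\<close>.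
\<close>

definition twist_kernel :: "nat \<Rightarrow> braid3 set" where
  "twist_kernel d = {x \<diamondop> full_twist [^]\<^bsub>B3\<^esub> (k::int) | x k. x \<in> twist_powers d}"

lemma twist_kernelI: "x \<in> twist_powers d \<Longrightarrow> x \<diamondop> full_twist [^]\<^bsub>B3\<^esub> (k::int) \<in> twist_kernel d"
  by (auto simp: twist_kernel_def)

lemma twist_kernel_normal: "twist_kernel d \<lhd> B3"
proof -
  interpret N: normal "twist_powers d" B3 by (rule twist_powers_normal)
  show ?thesis
    unfolding B3.normal_inv_iff
  proof (intro conjI ballI)
    show "subgroup (twist_kernel d) B3"
    proof
      show "\<one>\<^bsub>B3\<^esub> \<in> twist_kernel d" using twist_kernelI[of "\<one>\<^bsub>B3\<^esub>" d 0] by simp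
    next
      fix u v assume "u \<in> twist_kernel d" "v \<in> twist_kernel d"
      then obtain x k y j where *: "u = x \<diamondop> full_twist [^]\<^bsub>B3\<^esub> (k::int)" "v = y \<diamondop> full_twist [^]\<^bsub>B3\<^esub> (j::int)"
        "x \<in> twist_powers d" "y \<in> twist_powers d" by (auto simp: twist_kernel_def)
      have "u \<diamondop> v = x \<diamondop> (full_twist [^]\<^bsub>B3\<^esub> k \<diamondop> y) \<diamondop> full_twist [^]\<^bsub>B3\<^esub> j"
        by (simp add: * B3.m_assoc)
      also have "\<dots> = (x \<diamondop> y) \<diamondop> full_twist [^]\<^bsub>B3\<^esub> (k + j)"
        unfolding full_twist_pow_central[of k y] by (simp add: B3.m_assoc B3.int_pow_mult)
      finally show "u \<diamondop> v \<in> twist_kernel d" using * by (simp add: twist_kernelI)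
    next
      fix u assume "u \<in> twist_kernel d"
      then obtain x k where *: "u = x \<diamondop> full_twist [^]\<^bsub>B3\<^esub> (k::int)" "x \<in> twist_powers d"
        by (auto simp: twist_kernel_def)
      have "inv\<^bsub>B3\<^esub> u = inv\<^bsub>B3\<^esub> x \<diamondop> full_twist [^]\<^bsub>B3\<^esub> (- k)"
        using full_twist_pow_central[of "- k" "inv\<^bsub>B3\<^esub> x"]
        by (simp add: * B3.inv_mult_group B3.int_pow_neg)
      then show "inv\<^bsub>B3\<^esub> u \<in> twist_kernel d" using * by (simp add: twist_kernelI)
    qed simp
  next
    fix y u assume "u \<in> twist_kernel d"
    then obtain x k where *: "u = x \<diamondop> full_twist [^]\<^bsub>B3\<^esub> (k::int)" "x \<in> twist_powers d"
      by (auto simp: twist_kernel_def)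
    have "y \<diamondop> u \<diamondop> inv\<^bsub>B3\<^esub> y = (y \<diamondop> x \<diamondop> inv\<^bsub>B3\<^esub> y) \<diamondop> full_twist [^]\<^bsub>B3\<^esub> k"
      by (simp add: * B3.m_assoc full_twist_pow_central[of k "inv\<^bsub>B3\<^esub> y"])
    then show "y \<diamondop> u \<diamondop> inv\<^bsub>B3\<^esub> y \<in> twist_kernel d"
      using * N.inv_op_closed2[of y x] by (simp add: twist_kernelI)
  qed
qed

lemma mirror_twist_kernel:
  assumes "u \<in> twist_kernel d"
  shows "mirror u \<in> twist_kernel d"
proof -
  obtain x k where *: "u = x \<diamondop> full_twist [^]\<^bsub>B3\<^esub> (k::int)" "x \<in> twist_powers d"
    using assms by (auto simp: twist_kernel_def)
  have "mirror u = mirror x \<diamondop> full_twist [^]\<^bsub>B3\<^esub> (- k)"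
    by (simp add: * mirror_mult mirror.hom_int_pow mirror_full_twist B3.int_pow_inv B3.int_pow_neg)
  then show ?thesis using * mirror_twist_powers by (simp add: twist_kernelI)
qed

section \<open>Braids as words in three reflections\<close>

datatype reflection = R1 | R2 | R3

text \<open>
  In the extension of \<open>B\<^sub>3\<close> by the mirror automorphism \<open>\<mu>\<close>, the three reflections are \<open>\<mu>\<close>, \<open>\<sigma>\<^sub>1 \<mu>\<close> and \<open>\<Delta> \<mu>\<close>
  with the half turn \<open>\<Delta>\<close>.  The products of two of them are \<open>\<sigma>\<^sub>1\<close>, \<open>\<Delta>\<close> and \<open>\<Delta> \<sigma>\<^sub>1\<inverse> = \<sigma>\<^sub>1 \<sigma>\<^sub>2\<close>, which have
  orders \<open>d\<close>, \<open>2\<close> and \<open>3\<close> modulo \<open>\<sigma>\<^sub>1\<^sup>d\<close> and the full twist.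
\<close>

fun offset :: "reflection \<Rightarrow> braid3" where
  "offset R1 = \<one>\<^bsub>B3\<^esub>"
| "offset R2 = half_twist S1"
| "offset R3 = half_turn"

text \<open>
  The braid component of a product of reflections in the semidirect product with the mirror
  automorphism; the other component is the parity of the length.
\<close>

fun word_braid :: "reflection list \<Rightarrow> braid3" where
  "word_braid [] = \<one>\<^bsub>B3\<^esub>"
| "word_braid (s # w) = offset s \<diamondop> mirror (word_braid w)"

definition exponent :: "nat \<Rightarrow> reflection \<Rightarrow> reflection \<Rightarrow> nat" where
  "exponent d s t = (if {s, t} = {R1, R2} then d else if {s, t} = {R1, R3} then 2 else 3)"

text \<open>
  Equality in the quotient of the extended group by \<open>twist_kernel d\<close>.  This replaces the Coxeter group
  of type \<open>(2, 3, d)\<close>.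
\<close>

definition word_eq :: "nat \<Rightarrow> reflection list \<Rightarrow> reflection list \<Rightarrow> bool" where
  "word_eq d u v \<longleftrightarrow> even (length u) = even (length v)
     \<and> inv\<^bsub>B3\<^esub> word_braid u \<diamondop> word_braid v \<in> twist_kernel d"

lemma word_eqI:
  assumes "even (length u) = even (length v)" "word_braid v = k \<diamondop> word_braid u" "k \<in> twist_kernel d"
  shows "word_eq d u v"
proof -
  interpret M: normal "twist_kernel d" B3 by (rule twist_kernel_normal)
  show ?thesis
    using assms M.inv_op_closed1[of "word_braid u" k] by (simp add: word_eq_def B3.m_assoc)
qed

lemma word_eq_equivp: "equivp (word_eq d)"
proof (rule equivpI)
  interpret M: normal "twist_kernel d" B3 by (rule twist_kernel_normal)
  show "reflp (word_eq d)" by (simp add: reflp_def word_eq_def)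
  show "symp (word_eq d)"
  proof (rule sympI)
    fix u v assume "word_eq d u v"
    then show "word_eq d v u"
      using M.m_inv_closed[of "inv\<^bsub>B3\<^esub> word_braid u \<diamondop> word_braid v"]
      by (simp add: word_eq_def B3.inv_mult_group)
  qed
  show "transp (word_eq d)"
  proof (rule transpI)
    fix u v w assume "word_eq d u v" "word_eq d v w"
    then show "word_eq d u w"
      using M.m_closed[of "inv\<^bsub>B3\<^esub> word_braid u \<diamondop> word_braid v" "inv\<^bsub>B3\<^esub> word_braid v \<diamondop> word_braid w"]
      by (simp add: word_eq_def B3.m_assoc)
  qed
qed

lemma word_eq_Cons:
  assumes "word_eq d u v"
  shows "word_eq d (s # u) (s # v)"
proof -
  have "inv\<^bsub>B3\<^esub> word_braid (s # u) \<diamondop> word_braid (s # v)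
      = mirror (inv\<^bsub>B3\<^esub> word_braid u \<diamondop> word_braid v)"
    by (simp add: mirror_mult B3.inv_mult_group B3.m_assoc)
  then show ?thesis
    using assms mirror_twist_kernel[of "inv\<^bsub>B3\<^esub> word_braid u \<diamondop> word_braid v" d]
    by (simp add: word_eq_def mirror_mult)
qed

lemma word_braid_involution: "word_braid (s # s # w) = word_braid w"
  by (cases s) (simp_all add: mirror_mult mirror_half_twist mirror_half_turn flip: B3.m_assoc)

text \<open>
  Two consecutive letters of an alternating word in \<open>R1\<close> and \<open>R2\<close> contribute one \<open>\<sigma>\<^sub>1\<close> or one \<open>\<sigma>\<^sub>1\<inverse>\<close>,
  depending on which comes first.  The two exponents add up to \<open>n\<close>, which makes the braid relation between
  \<open>R1\<close> and \<open>R2\<close> the relation \<open>\<sigma>\<^sub>1\<^sup>d = 1\<close>, for odd \<open>d\<close> as well as for even \<open>d\<close>.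
\<close>

lemma word_braid_alternating:
  "word_braid (alternating R2 R1 n @ w) = half_twist S1 [^]\<^bsub>B3\<^esub> (Suc n div 2) \<diamondop> (mirror ^^ n) (word_braid w)"
  "word_braid (alternating R1 R2 n @ w)
     = inv\<^bsub>B3\<^esub> (half_twist S1 [^]\<^bsub>B3\<^esub> (n div 2)) \<diamondop> (mirror ^^ n) (word_braid w)"
proof (induction n)
  case (Suc n)
  have mirror_pow: "mirror (half_twist S1 [^]\<^bsub>B3\<^esub> k) = inv\<^bsub>B3\<^esub> (half_twist S1 [^]\<^bsub>B3\<^esub> k)" for k :: nat
    by (simp add: mirror.hom_nat_pow mirror_half_twist B3.nat_pow_inv)
  have "half_twist S1 \<diamondop> half_twist S1 [^]\<^bsub>B3\<^esub> k = half_twist S1 [^]\<^bsub>B3\<^esub> Suc k" for k :: nat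
    using B3.nat_pow_mult[of "half_twist S1" 1 k] by simp
  then show "word_braid (alternating R2 R1 (Suc n) @ w)
      = half_twist S1 [^]\<^bsub>B3\<^esub> (Suc (Suc n) div 2) \<diamondop> (mirror ^^ Suc n) (word_braid w)"
    by (simp add: Suc.IH mirror_mult mirror_pow flip: B3.m_assoc del: B3.nat_pow_Suc)
  show "word_braid (alternating R1 R2 (Suc n) @ w)
     = inv\<^bsub>B3\<^esub> (half_twist S1 [^]\<^bsub>B3\<^esub> (Suc n div 2)) \<diamondop> (mirror ^^ Suc n) (word_braid w)"
    by (simp add: Suc.IH mirror_mult mirror_pow del: B3.nat_pow_Suc)
qed simp_all

lemma twist_in_kernel: "half_twist S1 [^]\<^bsub>B3\<^esub> d \<in> twist_kernel d"
  using generators_in_normal_closure[of "{half_twist S1 [^]\<^bsub>B3\<^esub> d}" B3]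
    twist_kernelI[of "half_twist S1 [^]\<^bsub>B3\<^esub> d" d 0] by (simp add: twist_powers_def)

lemma full_twist_in_kernel: "full_twist \<in> twist_kernel d"
proof -
  interpret N: normal "twist_powers d" B3 by (rule twist_powers_normal)
  show ?thesis using twist_kernelI[of "\<one>\<^bsub>B3\<^esub>" d 1] by simp
qed

text \<open>
  Equivalent to \<open>(\<sigma>\<^sub>1 \<sigma>\<^sub>2)\<^sup>3 = \<tau>\<close>, in the form needed for the braid relation between \<open>R2\<close> and \<open>R3\<close>.
\<close>

lemma half_turn_conj: "half_turn \<diamondop> inv\<^bsub>B3\<^esub> half_twist S1 \<diamondop> half_turn
   = full_twist \<diamondop> (half_twist S1 \<diamondop> inv\<^bsub>B3\<^esub> half_turn \<diamondop> half_twist S1)"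
proof -
  have "half_turn \<diamondop> inv\<^bsub>B3\<^esub> half_twist S1 = half_twist S1 \<diamondop> half_twist S2"
    by (simp add: half_turn_def B3.m_assoc)
  then have "half_turn \<diamondop> inv\<^bsub>B3\<^esub> half_twist S1 \<diamondop> half_turn = half_twist S1 \<diamondop> half_turn \<diamondop> half_twist S1"
    by (simp add: B3.m_assoc half_turn_S1)
  also have "\<dots> = half_twist S1 \<diamondop> (full_twist \<diamondop> inv\<^bsub>B3\<^esub> half_turn) \<diamondop> half_twist S1"
    by (simp add: full_twist_eq B3.m_assoc)
  also have "\<dots> = full_twist \<diamondop> (half_twist S1 \<diamondop> inv\<^bsub>B3\<^esub> half_turn \<diamondop> half_twist S1)"
    by (metis B3.m_assoc UNIV_I carrier_B3 full_twist_central)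
  finally show ?thesis .
qed

lemma word_eq_braid_12:
  "word_eq d (alternating R1 R2 d @ w) (alternating R2 R1 d @ w)"
proof (rule word_eqI[OF _ _ twist_in_kernel])
  have len: "length (alternating a b n) = n" for a b :: reflection and n
    by (induction n arbitrary: a b) auto
  then show "even (length (alternating R1 R2 d @ w)) = even (length (alternating R2 R1 d @ w))"
    by simp
  have "Suc d div 2 + d div 2 = d" by presburger
  then have "half_twist S1 [^]\<^bsub>B3\<^esub> d = half_twist S1 [^]\<^bsub>B3\<^esub> (Suc d div 2) \<diamondop> half_twist S1 [^]\<^bsub>B3\<^esub> (d div 2)"
    by (simp only: B3.nat_pow_mult carrier_B3 UNIV_I)
  then show "word_braid (alternating R2 R1 d @ w)
    = half_twist S1 [^]\<^bsub>B3\<^esub> d \<diamondop> word_braid (alternating R1 R2 d @ w)"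
    unfolding word_braid_alternating by (simp add: B3.m_assoc)
qed

lemma word_eq_braid_13: "word_eq d (R1 # R3 # w) (R3 # R1 # w)"
  by (rule word_eqI[OF _ _ full_twist_in_kernel])
     (simp_all add: mirror_mult mirror_half_turn full_twist_eq B3.m_assoc)

lemma word_eq_braid_23: "word_eq d (R2 # R3 # R2 # w) (R3 # R2 # R3 # w)"
proof (rule word_eqI[OF _ _ full_twist_in_kernel])
  show "word_braid (R3 # R2 # R3 # w) = full_twist \<diamondop> word_braid (R2 # R3 # R2 # w)"
    using half_turn_conj
    by (simp add: mirror_mult mirror_half_twist mirror_half_turn)
       (metis B3.m_assoc UNIV_I carrier_B3)
qed simp

lemma word_eq_braid:
  assumes "s \<noteq> t"
  shows "word_eq d (alternating s t (exponent d s t) @ w) (alternating t s (exponent d s t) @ w)"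
proof -
  have sym: "word_eq d v u" if "word_eq d u v" for u v
    using that word_eq_equivp equivp_symp by metis
  show ?thesis
    using assms word_eq_braid_12 word_eq_braid_13 word_eq_braid_23
    by (cases s; cases t)
       (auto simp: exponent_def doubleton_eq_iff numeral_2_eq_2 numeral_3_eq_3 intro: sym)
qed

text \<open>
  The generators are even words: \<open>\<sigma>\<^sub>1\<close> is \<open>R2 R1\<close>, and \<open>\<sigma>\<^sub>2 = \<sigma>\<^sub>1\<inverse> \<Delta> \<sigma>\<^sub>1\<inverse>\<close>.
\<close>

lemma even_word_braid_surj: "\<exists>w. even (length w) \<and> word_braid w = x"
proof (induction x rule: braid_induct)
  case one
  show ?case by (rule exI[of _ "[]"]) simp
next
  case (twist g x)
  then obtain w where w: "even (length w)" "word_braid w = x" by blast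
  show ?case
  proof (cases g)
    case S1
    then show ?thesis using w by (intro exI[of _ "R2 # R1 # w"]) simp
  next
    case S2
    have "half_twist S2 = inv\<^bsub>B3\<^esub> half_twist S1 \<diamondop> half_turn \<diamondop> inv\<^bsub>B3\<^esub> half_twist S1"
      by (simp add: half_turn_def B3.m_assoc)
    with S2 show ?thesis using w
      by (intro exI[of _ "[R1, R2, R3, R1, R1, R2] @ w"])
         (simp add: mirror_mult mirror_half_twist mirror_half_turn B3.m_assoc)
  qed
next
  case (untwist g x)
  then obtain w where w: "even (length w)" "word_braid w = x" by blast
  show ?case
  proof (cases g)
    case S1
    then show ?thesis using w
      by (intro exI[of _ "R1 # R2 # w"]) (simp add: mirror_mult mirror_half_twist)
  next
    case S2
    have "inv\<^bsub>B3\<^esub> half_twist S2 = half_twist S1 \<diamondop> inv\<^bsub>B3\<^esub> half_turn \<diamondop> half_twist S1"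
      by (simp add: half_turn_def B3.m_assoc B3.inv_mult_group)
    with S2 show ?thesis using w
      by (intro exI[of _ "[R2, R1, R1, R3, R2, R1] @ w"])
         (simp add: mirror_mult mirror_half_twist mirror_half_turn B3.m_assoc)
  qed
qed

section \<open>The Burau action and its invariant forms\<close>

definition act :: "complex \<Rightarrow> braid3 \<Rightarrow> complex ^ 2 \<Rightarrow> complex ^ 2" where
  "act t x v = burau3_at t x *v v"

lemma vec2_eq_iff: "(v :: 'a ^ 2) = w \<longleftrightarrow> v $ 1 = w $ 1 \<and> v $ 2 = w $ 2"
  by (simp add: vec_eq_iff forall_2)

lemma laurent_eval_uminus: "laurent_eval z (- p) = - laurent_eval z p"
  using laurent_eval_add[of z p "- p"] by (simp add: laurent_eval_zero eq_neg_iff_add_eq_0 add.commute)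

lemma laurent_eval_t_var: "laurent_eval z t_var = z"
  by (simp add: t_var_def laurent_eval_single)

lemma act_half_twist:
  "act t (half_twist S1) v = vector [- t * v $ 1 + v $ 2, v $ 2]"
  "act t (half_twist S2) v = vector [v $ 1, t * v $ 1 - t * v $ 2]"
  by (simp_all add: act_def burau3_at_def burau3_half_twist vec2_eq_iff matrix_vector_mult_def sum_2
        laurent_eval_uminus laurent_eval_t_var laurent_eval_one laurent_eval_zero)

context
  fixes t :: complex
  assumes t_nz: "t \<noteq> 0"
begin

interpretation burau: group_hom B3 "GL :: (complex ^ 2 ^ 2) monoid" "burau3_at t"
  by (intro group_hom.intro group_hom_axioms.intro group_B3 group_GL burau3_at_hom[OF t_nz])

lemma act_one: "act t \<one>\<^bsub>B3\<^esub> v = v"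
  using burau.hom_one by (simp add: act_def GL_def)

lemma act_mult: "act t (x \<diamondop> y) v = act t x (act t y v)"
  using burau.hom_mult[of x y] by (simp add: act_def GL_def matrix_vector_mul_assoc)

lemma act_inv [simp]: "act t x (act t (inv\<^bsub>B3\<^esub> x) v) = v" "act t (inv\<^bsub>B3\<^esub> x) (act t x v) = v"
  by (simp_all add: act_one flip: act_mult)

lemma act_inv_eqI: "v = act t x w \<Longrightarrow> act t (inv\<^bsub>B3\<^esub> x) v = w"
  by simp

lemma act_kernel_iff: "x \<in> kernel B3 GL (burau3_at t) \<longleftrightarrow> (\<forall>v. act t x v = v)"
proof -
  have "x \<in> kernel B3 GL (burau3_at t) \<longleftrightarrow> burau3_at t x = mat 1"
    by (simp add: kernel_def GL_def)
  also have "\<dots> \<longleftrightarrow> (\<forall>v. act t x v = v)"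
    unfolding act_def by (metis matrix_eq matrix_vector_mul_lid)
  finally show ?thesis .
qed

lemma kernel_normal: "kernel B3 GL (burau3_at t) \<lhd> B3"
  by (rule burau.normal_kernel)

lemma act_scale: "act t x (c *s v) = c *s act t x v"
  by (simp add: act_def vec2_eq_iff matrix_vector_mult_def sum_2 algebra_simps)

lemma act_half_turn: "act t half_turn v = vector [- t * v $ 2, - t\<^sup>2 * v $ 1]"
  by (simp add: half_turn_def act_mult act_half_twist vec2_eq_iff power2_eq_square algebra_simps)

lemma act_full_twist: "act t full_twist v = t ^ 3 *s v"
  by (simp add: full_twist_eq act_mult act_half_turn vec2_eq_iff power2_eq_square power3_eq_cube)

lemma act_full_twist_pow: "act t (full_twist [^]\<^bsub>B3\<^esub> (k::int)) v = (t ^ 3) powi k *s v"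
proof -
  have nat: "act t (full_twist [^]\<^bsub>B3\<^esub> (n::nat)) v = (t ^ 3) ^ n *s v" for n v
  proof (induction n arbitrary: v)
    case 0
    then show ?case by (simp add: act_one)
  next
    case (Suc n)
    have "act t (full_twist [^]\<^bsub>B3\<^esub> Suc n) v = (t ^ 3) ^ n *s (t ^ 3 *s v)"
      by (simp only: B3.nat_pow_Suc act_mult act_full_twist Suc.IH)
    then show ?case by (simp only: vector_smult_assoc power_Suc2)
  qed
  show ?thesis
  proof (cases k rule: int_cases2)
    case (nonneg n)
    show ?thesis unfolding nonneg int_pow_int power_int_of_nat by (rule nat)
  next
    case (nonpos n)
    have nz: "(t ^ 3) ^ n \<noteq> 0" using t_nz by simp
    have "act t (inv\<^bsub>B3\<^esub> (full_twist [^]\<^bsub>B3\<^esub> n)) v = inverse ((t ^ 3) ^ n) *s v"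
      by (rule act_inv_eqI) (simp only: nat vector_smult_assoc right_inverse[OF nz] vector_smult_lid)
    then show ?thesis
      unfolding nonpos by (simp only: B3.int_pow_neg int_pow_int power_int_minus power_int_of_nat carrier_B3 UNIV_I)
  qed
qed

end

text \<open>
  The Burau matrix of \<open>\<sigma>\<^sub>1\<close> has the eigenvalues \<open>q \<noteq> 1\<close> and \<open>1\<close>, so its \<open>d\<close>-th power is the identity.
\<close>

lemma act_half_twist_pow:
  assumes "q \<noteq> 0" "q ^ d = 1" "q \<noteq> 1"
  shows "act (- q) (half_twist S1 [^]\<^bsub>B3\<^esub> d) v = v"
proof -
  have nz: "- q \<noteq> 0" using assms(1) by simp
  have "act (- q) (half_twist S1 [^]\<^bsub>B3\<^esub> (n::nat)) v = vector [q ^ n * v $ 1 + (\<Sum>i<n. q ^ i) * v $ 2, v $ 2]" for n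
    by (induction n arbitrary: v)
       (simp_all add: act_one[OF nz] act_mult[OF nz] act_half_twist vec2_eq_iff algebra_simps)
  moreover have "(\<Sum>i<d. q ^ i) = 0" using geometric_sum[OF assms(3), of d] assms(2) by simp
  ultimately show ?thesis using assms(2) by (simp add: vec2_eq_iff)
qed

lemma twist_powers_subset_kernel:
  assumes "q \<noteq> 0" "q ^ d = 1" "q \<noteq> 1"
  shows "twist_powers d \<subseteq> kernel B3 GL (burau3_at (- q))"
  unfolding twist_powers_def
  using assms act_half_twist_pow[OF assms]
  by (intro normal_closure_least kernel_normal) (auto simp: act_kernel_iff)

text \<open>
  The antilinear involution that implements the mirror automorphism.  For \<open>\<bar>t\<bar> = 1\<close> the complex conjugate of
  a Burau matrix of \<open>x\<close> is conjugate to that of \<open>mirror x\<close>, by the diagonal matrix with entries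
  \<open>1/t\<close> and \<open>1\<close>.
\<close>

definition conj_vec :: "complex \<Rightarrow> complex ^ 2 \<Rightarrow> complex ^ 2" where
  "conj_vec t v = vector [inverse t * cnj (v $ 1), cnj (v $ 2)]"

lemma cnj_eq_inverse: "cmod z = 1 \<Longrightarrow> cnj z = inverse z"
  using complex_norm_square[of z] by (intro inverse_unique[symmetric]) simp

lemma conj_vec_involution: "cmod t = 1 \<Longrightarrow> conj_vec t (conj_vec t v) = v"
  by (cases "t = 0") (simp_all add: conj_vec_def vec2_eq_iff cnj_eq_inverse)

lemma conj_vec_funpow: "cmod t = 1 \<Longrightarrow> (conj_vec t ^^ n) v = (if even n then v else conj_vec t v)"
  by (induction n) (auto simp: conj_vec_involution)

lemma act_mirror:
  assumes t: "cmod t = 1"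
  shows "act t (mirror x) (conj_vec t v) = conj_vec t (act t x v)"
proof (induction x arbitrary: v rule: braid_induct)
  have nz: "t \<noteq> 0" using t by auto
  have cnj_t: "cnj t = inverse t" using t by (rule cnj_eq_inverse)
  have gen: "act t (inv\<^bsub>B3\<^esub> half_twist g) (conj_vec t v) = conj_vec t (act t (half_twist g) v)" for g v
  proof (rule act_inv_eqI[OF nz])
    show "conj_vec t v = act t (half_twist g) (conj_vec t (act t (half_twist g) v))"
      using nz by (cases g) (simp_all add: act_half_twist conj_vec_def vec2_eq_iff cnj_t field_simps)
  qed
  {
    case one
    show ?case by (simp add: act_one[OF nz])
  next
    case (twist g x)
    then show ?case by (simp add: mirror_mult mirror_half_twist act_mult[OF nz] gen)
  next
    case (untwist g x)
    have "act t (half_twist g) (conj_vec t w) = conj_vec t (act t (inv\<^bsub>B3\<^esub> half_twist g) w)" for w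
      using gen[of g "act t (inv\<^bsub>B3\<^esub> half_twist g) w"] act_inv[OF nz] by metis
    with untwist show ?case
      by (simp add: mirror_mult mirror_half_twist act_mult[OF nz])
  }
qed

definition reflect :: "complex \<Rightarrow> reflection \<Rightarrow> complex ^ 2 \<Rightarrow> complex ^ 2" where
  "reflect t s v = act t (offset s) (conj_vec t v)"

lemma foldr_reflect:
  assumes "cmod t = 1"
  shows "foldr (reflect t) w v = act t (word_braid w) ((conj_vec t ^^ length w) v)"
proof -
  have nz: "t \<noteq> 0" using assms by auto
  show ?thesis
    by (induction w) (simp_all add: reflect_def act_one[OF nz] act_mult[OF nz] act_mirror[OF assms])
qed

text \<open>
  The form of a reflection changes sign under that reflection, which determines it up to a
  real factor; its zero set is the mirror.  The factors are chosen to fit the rule of the numbers game.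
\<close>

fun form :: "complex \<Rightarrow> reflection \<Rightarrow> complex ^ 2 \<Rightarrow> real" where
  "form h R1 v = 2 * Re (h * v $ 1 * cnj (v $ 2))"
| "form h R2 v = (cmod (v $ 2))\<^sup>2 - 2 * Re (v $ 1 * cnj (v $ 2))"
| "form h R3 v = (cmod (v $ 1))\<^sup>2 - (cmod (v $ 2))\<^sup>2"

lemma reflect_explicit:
  assumes "cmod h = 1" and "t = - h\<^sup>2"
  shows "reflect t R1 v = vector [- (cnj h)\<^sup>2 * cnj (v $ 1), cnj (v $ 2)]"
    and "reflect t R2 v = vector [cnj (v $ 2) - cnj (v $ 1), cnj (v $ 2)]"
    and "reflect t R3 v = vector [h\<^sup>2 * cnj (v $ 2), h\<^sup>2 * cnj (v $ 1)]"
proof -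
  have nz: "h \<noteq> 0" "t \<noteq> 0" using assms by auto
  have inv_h: "cnj h = inverse h" using assms(1) by (rule cnj_eq_inverse)
  show "reflect t R1 v = vector [- (cnj h)\<^sup>2 * cnj (v $ 1), cnj (v $ 2)]"
    by (simp add: reflect_def act_one[OF nz(2)]) (simp add: conj_vec_def vec2_eq_iff assms(2) inv_h power_inverse)
  show "reflect t R2 v = vector [cnj (v $ 2) - cnj (v $ 1), cnj (v $ 2)]"
    using nz by (simp add: reflect_def act_half_twist conj_vec_def vec2_eq_iff)
  show "reflect t R3 v = vector [h\<^sup>2 * cnj (v $ 2), h\<^sup>2 * cnj (v $ 1)]"
    using nz by (simp add: reflect_def act_half_turn conj_vec_def vec2_eq_iff assms(2) power2_eq_square field_simps)
qed

text \<open>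
  With \<open>h = exp(\<pi>i/d)\<close> we have \<open>2 Re h = 2 cos (\<pi>/d)\<close>, and the coefficients \<open>0\<close> and \<open>1\<close> are \<open>2 cos (\<pi>/2)\<close> and
  \<open>2 cos (\<pi>/3)\<close>: this is the geometric representation of the Coxeter group of type \<open>(2, 3, d)\<close>.
  In real coordinates each equation is a polynomial identity modulo \<open>a\<^sup>2 + b\<^sup>2 = 1\<close>.
\<close>

lemma form_reflect:
  assumes h: "cmod h = 1"
  shows "form h R1 (reflect (- h\<^sup>2) R1 v) = - form h R1 v"
    and "form h R2 (reflect (- h\<^sup>2) R2 v) = - form h R2 v"
    and "form h R3 (reflect (- h\<^sup>2) R3 v) = - form h R3 v"
    and "form h R1 (reflect (- h\<^sup>2) R2 v) = form h R1 v + 2 * Re h * form h R2 v"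
    and "form h R2 (reflect (- h\<^sup>2) R1 v) = form h R2 v + 2 * Re h * form h R1 v"
    and "form h R1 (reflect (- h\<^sup>2) R3 v) = form h R1 v"
    and "form h R3 (reflect (- h\<^sup>2) R1 v) = form h R3 v"
    and "form h R2 (reflect (- h\<^sup>2) R3 v) = form h R2 v + form h R3 v"
    and "form h R3 (reflect (- h\<^sup>2) R2 v) = form h R3 v + form h R2 v"
proof -
  obtain a b where hab: "h = Complex a b" by (cases h)
  obtain x y where x: "v $ 1 = Complex x y" by (cases "v $ 1")
  obtain z w where z: "v $ 2 = Complex z w" by (cases "v $ 2")
  have ab: "a\<^sup>2 + b\<^sup>2 = 1" using h by (simp add: hab cmod_def)
  note forms = form.simps reflect_explicit[OF h HOL.refl] vector_2
  note coords = x z hab cmod_power2 power2_eq_square[of "Complex _ _"]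
    complex_cnj complex_mult complex_diff complex_minus complex.sel
  show "form h R1 (reflect (- h\<^sup>2) R1 v) = - form h R1 v"
    unfolding forms unfolding coords using ab by Groebner_Basis.algebra
  show "form h R2 (reflect (- h\<^sup>2) R2 v) = - form h R2 v"
    unfolding forms unfolding coords by (simp add: power2_eq_square algebra_simps)
  show "form h R3 (reflect (- h\<^sup>2) R3 v) = - form h R3 v"
    unfolding forms unfolding coords using ab by Groebner_Basis.algebra
  show "form h R1 (reflect (- h\<^sup>2) R2 v) = form h R1 v + 2 * Re h * form h R2 v"
    unfolding forms unfolding coords by (simp add: power2_eq_square algebra_simps)
  show "form h R2 (reflect (- h\<^sup>2) R1 v) = form h R2 v + 2 * Re h * form h R1 v"
    unfolding forms unfolding coords using ab by Groebner_Basis.algebra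
  show "form h R1 (reflect (- h\<^sup>2) R3 v) = form h R1 v"
    unfolding forms unfolding coords using ab by Groebner_Basis.algebra
  show "form h R3 (reflect (- h\<^sup>2) R1 v) = form h R3 v"
    unfolding forms unfolding coords using ab by Groebner_Basis.algebra
  show "form h R2 (reflect (- h\<^sup>2) R3 v) = form h R2 v + form h R3 v"
    unfolding forms unfolding coords using ab by Groebner_Basis.algebra
  show "form h R3 (reflect (- h\<^sup>2) R2 v) = form h R3 v + form h R2 v"
    unfolding forms unfolding coords by (simp add: power2_eq_square algebra_simps)
qed

lemma form_scale: "form h s (c *s v) = (cmod c)\<^sup>2 * form h s v"
proof -
  have "k * (c * a) * cnj (c * b) = of_real ((cmod c)\<^sup>2) * (k * a * cnj b)" for k a b
    by (simp add: complex_norm_square del: of_real_power)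
  moreover have "Re (of_real r * z) = r * Re z" for r z by simp
  ultimately have "Re (k * (c * a) * cnj (c * b)) = (cmod c)\<^sup>2 * Re (k * a * cnj b)" for k a b
    by (simp only:)
  from this[of h] this[of 1] show ?thesis
    by (cases s) (simp_all add: norm_mult power_mult_distrib right_diff_distrib del: times_complex.sel)
qed

section \<open>Faithfulness of the hyperbolic specialization\<close>

text \<open>
  The elements of \<open>twist_powers d\<close> act trivially, and the full twist acts by the scalar \<open>(-q)\<^sup>3\<close>.
\<close>

lemma twist_kernel_acts_by_unit_scalar:
  assumes "q ^ d = 1" "q \<noteq> 1" "cmod q = 1" and "x \<in> twist_kernel d"
  obtains c where "cmod c = 1" "\<And>v. act (- q) x v = c *s v"
proof -
  have q: "q \<noteq> 0" "- q \<noteq> 0" using assms(3) by auto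
  obtain y k where x: "x = y \<diamondop> full_twist [^]\<^bsub>B3\<^esub> (k::int)" and y: "y \<in> twist_powers d"
    using assms(4) by (auto simp: twist_kernel_def)
  have "act (- q) y v = v" for v
    using twist_powers_subset_kernel[OF q(1) assms(1,2)] y act_kernel_iff[OF q(2)] by blast
  then have "act (- q) x v = ((- q) ^ 3) powi k *s v" for v
    by (simp only: x act_mult[OF q(2)] act_full_twist_pow[OF q(2)] act_scale[OF q(2)])
  moreover have "cmod (((- q) ^ 3) powi k) = 1"
    using assms(3) by (simp add: norm_power_int norm_power)
  ultimately show thesis using that by blast
qed

lemma cis_half_angle: "(cis (pi / real d))\<^sup>2 = cis (2 * pi / real d)"
  by (simp add: power2_eq_square cis_mult)

text \<open>
  The vector \<open>(r exp(i\<theta>), 1)\<close> with \<open>r\<close> slightly above \<open>1\<close> lies in the chamber if \<open>\<pi>/3 < \<theta> < \<pi>/2 - \<pi>/d\<close>.  This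
  interval is nonempty exactly for \<open>d > 6\<close>: the angle sum of the triangle has to be less than \<open>\<pi>\<close>.
\<close>

lemma exists_point_in_chamber:
  fixes d :: nat
  assumes "d \<ge> 7"
  shows "\<exists>v. \<forall>s. 0 < form (cis (pi / d)) s v"
proof -
  define e where "e = pi / d"
  \<comment> \<open>The midpoint of the interval between \<open>\<pi>/3\<close> and \<open>\<pi>/2 - \<pi>/d\<close>.\<close>
  define \<theta> where "\<theta> = 5 * pi / 12 - e / 2"
  have e: "e < pi / 6" "0 < e"
    unfolding e_def using assms by - (intro divide_strict_left_mono, simp_all)
  have \<theta>: "pi / 3 < \<theta>" "\<theta> + e < pi / 2" "\<theta> < pi / 2"
    unfolding \<theta>_def using e by - linarith+
  have "cos \<theta> < cos (pi / 3)" using \<theta> pi_gt_zero by (intro cos_monotone_0_pi) auto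
  then have cos: "0 < cos \<theta>" "2 * cos \<theta> < 1"
    using \<theta> pi_gt_zero by (auto simp: cos_60 intro!: cos_gt_zero)
  \<comment> \<open>The bound \<open>1 < r\<close> makes the form of \<open>R3\<close> positive, and \<open>2 r cos \<theta> < 1\<close> that of \<open>R2\<close>.\<close>
  obtain r where r: "1 < r" "r < 1 / (2 * cos \<theta>)"
    using dense[of 1 "1 / (2 * cos \<theta>)"] cos by auto
  let ?v = "vector [of_real r * cis \<theta>, 1] :: complex ^ 2"
  have "0 < form (cis (pi / d)) s ?v" for s
  proof (cases s)
    case R1
    have "0 < cos (\<theta> + e)"
      by (rule cos_gt_zero_pi) (use \<theta> e pi_gt_zero in linarith)+
    then have "0 < r * cos (\<theta> + e)" using r(1) by simp
    moreover have "Re (cis e * (of_real r * cis \<theta>)) = r * cos (\<theta> + e)"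
      by (simp add: cos_add algebra_simps)
    ultimately show ?thesis
      by (simp only: R1 form.simps e_def[symmetric] vector_2 complex_cnj_one mult_1_right)
  next
    case R2
    then show ?thesis using r(2) cos by (simp add: field_simps)
  next
    case R3
    then show ?thesis using r(1) by (simp add: norm_mult)
  qed
  then show ?thesis by blast
qed

text \<open>
  The numbers \<open>\<Phi> w s\<close> depend only on the class of \<open>w\<close> because \<open>twist_kernel d\<close> acts by scalars of modulus \<open>1\<close>,
  and these preserve the forms.
\<close>

lemma reflection_chambers_coxeter_game:
  fixes d :: nat
  defines "h \<equiv> cis (pi / d)"
  assumes d: "d \<ge> 7" and v: "\<And>s. 0 < form h s v"
  shows "coxeter_game (word_eq d) (exponent d) (\<lambda>w s. form h s (foldr (reflect (- h\<^sup>2)) w v))"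
proof
  have h: "cmod h = 1" by (simp add: h_def)
  have h2: "h\<^sup>2 = cis (2 * pi / d)" by (simp add: h_def cis_half_angle)
  have q: "(h\<^sup>2) ^ d = 1" "h\<^sup>2 \<noteq> 1" "cmod (h\<^sup>2) = 1"
  proof -
    show "(h\<^sup>2) ^ d = 1" using d by (simp add: h2 Complex.DeMoivre)
    show "cmod (h\<^sup>2) = 1" using h by (simp add: norm_power)
    have "cos (2 * pi / d) < cos 0"
      using d pi_gt_zero by (intro cos_monotone_0_pi) (auto simp: field_simps)
    then have "Re (h\<^sup>2) \<noteq> 1" by (simp add: h2)
    then show "h\<^sup>2 \<noteq> 1" by (metis one_complex.sel(1))
  qed
  have t: "cmod (- h\<^sup>2) = 1" using q(3) by simp
  then have nz: "- h\<^sup>2 \<noteq> 0" by force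
  show "equivp (word_eq d)" by (rule word_eq_equivp)
  show "word_eq d (s # u) (s # w)" if "word_eq d u w" for s u w
    using that by (rule word_eq_Cons)
  show "even (length u) = even (length w)" if "word_eq d u w" for u w
    using that by (simp add: word_eq_def)
  show "word_eq d (s # s # w) w" for s w
  proof -
    interpret M: normal "twist_kernel d" B3 by (rule twist_kernel_normal)
    show ?thesis by (rule word_eqI[where k = "\<one>\<^bsub>B3\<^esub>"]) (simp_all add: word_braid_involution del: word_braid.simps)
  qed
  show "2 \<le> exponent d s r" for s r using d by (simp add: exponent_def)
  show "exponent d s r = exponent d r s" for s r by (simp add: exponent_def insert_commute)
  show "word_eq d (alternating s r (exponent d s r) @ w) (alternating r s (exponent d s r) @ w)"
    if "s \<noteq> r" for s r w using that by (rule word_eq_braid)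
  show "(\<lambda>s. form h s (foldr (reflect (- h\<^sup>2)) u v)) = (\<lambda>s. form h s (foldr (reflect (- h\<^sup>2)) w v))"
    if "word_eq d u w" for u w
  proof -
    let ?K = "conj_vec (- h\<^sup>2)"
    define k where "k = inv\<^bsub>B3\<^esub> word_braid u \<diamondop> word_braid w"
    have k: "k \<in> twist_kernel d" "word_braid w = word_braid u \<diamondop> k"
      using that by (simp_all add: word_eq_def k_def)
    obtain c where c: "cmod c = 1" "\<And>x. act (- h\<^sup>2) k x = c *s x"
      using twist_kernel_acts_by_unit_scalar[OF q k(1)] by blast
    have "(?K ^^ length u) v = (?K ^^ length w) v"
      using that by (simp add: word_eq_def conj_vec_funpow[OF t])
    then have "foldr (reflect (- h\<^sup>2)) w v = c *s foldr (reflect (- h\<^sup>2)) u v"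
      by (simp only: foldr_reflect[OF t] k(2) act_mult[OF nz] c(2) act_scale[OF nz])
    then show ?thesis using c(1) by (simp add: form_scale)
  qed
  show "form h s (foldr (reflect (- h\<^sup>2)) (s # w) v) = - form h s (foldr (reflect (- h\<^sup>2)) w v)" for s w
    using form_reflect(1-3)[OF h] by (cases s) (simp_all del: form.simps)
  show "form h s (foldr (reflect (- h\<^sup>2)) (r # w) v) = form h s (foldr (reflect (- h\<^sup>2)) w v)
      + 2 * cos (pi / real (exponent d s r)) * form h r (foldr (reflect (- h\<^sup>2)) w v)"
    if "s \<noteq> r" for s r w
  proof -
    have "exponent d s r = (if s = R3 \<or> r = R3 then if s = R1 \<or> r = R1 then 2 else 3 else d)"
      using that by (cases s; cases r) (auto simp: exponent_def doubleton_eq_iff)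
    moreover have "Re h = cos (pi / d)" by (simp add: h_def)
    ultimately show ?thesis
      using that form_reflect(4-9)[OF h]
      by (cases s; cases r) (simp_all add: cos_60 del: form.simps)
  qed
  show "0 < form h s (foldr (reflect (- h\<^sup>2)) [] v)" for s using v by simp
qed

text \<open>
  A braid is an even word in the reflections, and even words act through the Burau matrices.  If
  this action is trivial, the word fixes the point in the open chamber, hence is trivial.
\<close>

theorem trivial_action_in_twist_kernel:
  fixes d :: nat
  assumes d: "d \<ge> 7" and x: "x \<in> kernel B3 GL (burau3_at (- cis (2 * pi / d)))"
  shows "x \<in> twist_kernel d"
proof -
  define h where "h = cis (pi / d)"
  define t where "t = - h\<^sup>2"
  have t_eq: "- cis (2 * pi / d) = t" by (simp add: t_def h_def cis_half_angle)
  have t: "cmod t = 1" by (simp add: t_def h_def norm_power)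
  then have nz: "t \<noteq> 0" by force
  obtain v where v: "\<And>s. 0 < form h s v"
    using exists_point_in_chamber[OF d] unfolding h_def by blast
  interpret coxeter_game "word_eq d" "exponent d" "\<lambda>w s. form h s (foldr (reflect t) w v)"
    using reflection_chambers_coxeter_game[OF d] v unfolding h_def t_def by blast
  obtain w where w: "even (length w)" "word_braid w = x" using even_word_braid_surj by blast
  have "(conj_vec t ^^ length w) v = v"
    using w(1) by (simp add: conj_vec_funpow[OF t])
  then have "foldr (reflect t) w v = v"
    using x act_kernel_iff[OF nz, of x] by (simp add: foldr_reflect[OF t] w(2) t_eq)
  then have "word_eq d w []" using trivial_if_\<Phi>_pos[of w] v by simp
  then have "inv\<^bsub>B3\<^esub> x \<in> twist_kernel d" by (simp add: word_eq_def w(2))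
  moreover interpret M: normal "twist_kernel d" B3 by (rule twist_kernel_normal)
  have "inv\<^bsub>B3\<^esub> (inv\<^bsub>B3\<^esub> x) \<in> twist_kernel d" if "inv\<^bsub>B3\<^esub> x \<in> twist_kernel d"
    using that by (rule M.m_inv_closed)
  ultimately show ?thesis by simp
qed

section \<open>The order of the scalar of the full twist\<close>

lemma primitive_root_power_eq_1_iff:
  assumes "primitive_root_of_unity d q"
  shows "q ^ n = 1 \<longleftrightarrow> d dvd n"
proof -
  have d: "d > 0" "q ^ d = 1" and least: "\<And>k. 0 < k \<Longrightarrow> k < d \<Longrightarrow> q ^ k \<noteq> 1"
    using assms by (auto simp: primitive_root_of_unity_def)
  have "q ^ n = (q ^ d) ^ (n div d) * q ^ (n mod d)"
    by (simp flip: power_mult power_add)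
  then have "q ^ n = q ^ (n mod d)" using d by simp
  then show ?thesis using least[of "n mod d"] d(1) by (cases "n mod d = 0") (auto simp: mod_eq_0_iff_dvd)
qed

text \<open>
  A primitive \<open>d\<close>-th root of unity has a square root that is a primitive root of order \<open>2 d\<close>: of the two square
  roots, one has \<open>d\<close>-th power \<open>-1\<close>.
\<close>

lemma square_root_of_even_order:
  assumes "primitive_root_of_unity d q"
  obtains \<eta> where "\<eta> ^ 2 = q" "\<eta> ^ d = -1" "\<And>n. \<eta> ^ n = 1 \<longleftrightarrow> 2 * d dvd n"
proof -
  have qn: "q ^ n = 1 \<longleftrightarrow> d dvd n" for n by (rule primitive_root_power_eq_1_iff[OF assms])
  have d: "d > 0" using assms by (simp add: primitive_root_of_unity_def)
  have r2: "csqrt q ^ 2 = q" by simp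
  have "(csqrt q ^ d) ^ 2 = q ^ d" by (metis power_commutes power_mult r2 mult.commute)
  then have r: "csqrt q ^ d = 1 \<or> csqrt q ^ d = -1" using qn[of d] by (simp add: power2_eq_1_iff)
  obtain \<eta> where \<eta>: "\<eta> ^ 2 = q" "\<eta> ^ d = -1"
  proof (cases "csqrt q ^ d = 1")
    case True
    have "odd d"
    proof
      assume "even d"
      then obtain e where e: "d = 2 * e" by blast
      then have "q ^ e = 1" using True r2 by (simp add: power_mult)
      then show False using qn[of e] e d by (auto dest: dvd_imp_le)
    qed
    then show thesis using that[of "- csqrt q"] True by simp
  qed (use that[of "csqrt q"] r in auto)
  moreover have "\<eta> ^ n = 1 \<longleftrightarrow> 2 * d dvd n" for n
  proof
    assume n: "\<eta> ^ n = 1"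
    then have "q ^ n = 1" unfolding \<eta>(1)[symmetric] by (metis power_commutes power_mult power_one mult.commute)
    then obtain k where k: "n = d * k" using qn by blast
    then have "(-1::complex) ^ k = 1" using n \<eta>(2) by (simp add: power_mult)
    then have "even k" by (cases "even k") auto
    then show "2 * d dvd n" using k by auto
  next
    assume "2 * d dvd n"
    then obtain k where "n = 2 * d * k" by (rule dvdE)
    then have "n = d * (2 * k)" by simp
    then show "\<eta> ^ n = 1" using \<eta>(2) by (simp add: power_mult)
  qed
  ultimately show thesis using that by blast
qed

lemma dvd_mult_right_iff_div_gcd:
  fixes a b n :: nat
  assumes "a > 0"
  shows "a dvd n * b \<longleftrightarrow> a div gcd a b dvd n"
proof -
  let ?g = "gcd a b"
  have g: "?g > 0" using assms by simp
  have "a dvd n * b \<longleftrightarrow> (a div ?g) * ?g dvd (n * (b div ?g)) * ?g"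
    by (simp add: mult.assoc)
  also have "\<dots> \<longleftrightarrow> a div ?g dvd n * (b div ?g)"
    by (rule dvd_times_right_cancel_iff) (use g in simp)
  also have "\<dots> \<longleftrightarrow> a div ?g dvd n"
    using div_gcd_coprime[of a b] assms by (intro coprime_dvd_mult_left_iff) auto
  finally show ?thesis .
qed

text \<open>
  With a square root \<open>\<eta>\<close> of \<open>q\<close> of order \<open>2 d\<close> one has \<open>-q = \<eta>^(d + 2)\<close>, hence \<open>(-q)\<^sup>3 = \<eta>^(3 d + 6) = \<eta>^(d + 6)\<close>.  This power has order
  \<open>2 d / gcd (2 d) (d + 6)\<close>, and \<open>gcd (2 d) (d + 6) = gcd 12 (d + 6)\<close> because \<open>2 d = 2 (d + 6) - 12\<close>.
\<close>

lemma neg_root_cube_power_eq_1_iff: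
  assumes "primitive_root_of_unity d q" "l = 2 * d div gcd 12 (d + 6)"
  shows "((- q) ^ 3) ^ n = 1 \<longleftrightarrow> l dvd n"
proof -
  obtain \<eta> where \<eta>: "\<eta> ^ 2 = q" "\<eta> ^ d = -1" "\<And>n. \<eta> ^ n = 1 \<longleftrightarrow> 2 * d dvd n"
    using square_root_of_even_order[OF assms(1)] by blast
  have neg_q: "- q = \<eta> ^ (d + 2)" using \<eta>(1,2) by (simp add: power_add power2_eq_square)
  have "(d + 2) * 3 = (d + 6) + 2 * d" by simp
  then have "(- q) ^ 3 = \<eta> ^ (d + 6) * \<eta> ^ (2 * d)"
    unfolding neg_q power_mult[symmetric] power_add[symmetric] by (simp only:)
  also have "\<eta> ^ (2 * d) = 1" by (simp add: \<eta>(3))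
  finally have cube: "(- q) ^ 3 = \<eta> ^ (d + 6)" by simp
  have "((- q) ^ 3) ^ n = \<eta> ^ (n * (d + 6))"
    unfolding cube power_mult[symmetric] by (simp only: mult.commute)
  then have "((- q) ^ 3) ^ n = 1 \<longleftrightarrow> 2 * d dvd n * (d + 6)" by (simp only: \<eta>(3))
  also have "\<dots> \<longleftrightarrow> 2 * d div gcd (2 * d) (d + 6) dvd n"
    using assms(1) by (intro dvd_mult_right_iff_div_gcd) (simp add: primitive_root_of_unity_def)
  also have "gcd (2 * d) (d + 6) = gcd 12 (d + 6)"
  proof -
    have *: "int (2 * d) = - 12 + 2 * int (d + 6)" by simp
    have "gcd (int (2 * d)) (int (d + 6)) = gcd (- 12) (int (d + 6))"
      unfolding * by (metis gcd.commute gcd_add_mult mult.commute add.commute)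
    then have "int (gcd (2 * d) (d + 6)) = int (gcd 12 (d + 6))" by (simp flip: gcd_int_int_eq)
    then show ?thesis by simp
  qed
  finally show ?thesis unfolding assms(2) .
qed

lemma order_neg_root_cube:
  assumes "primitive_root_of_unity d q" "l = 2 * d div gcd 12 (d + 6)"
  shows "group.ord complex_units ((- q) ^ 3) = l"
proof -
  interpret U: group complex_units by (rule group_complex_units)
  have "q \<noteq> 0" using assms(1) by (auto simp: primitive_root_of_unity_def zero_power)
  then have q: "(- q) ^ 3 \<in> carrier complex_units" by (simp add: complex_units_def)
  have pow: "x [^]\<^bsub>complex_units\<^esub> n = x ^ n" for x and n :: nat
    by (induction n) (simp_all add: complex_units_def nat_pow_def mult.commute)
  have "U.ord ((- q) ^ 3) dvd n \<longleftrightarrow> l dvd n" for n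
    using U.pow_eq_id[OF q, of n] neg_root_cube_power_eq_1_iff[OF assms, of n]
    by (simp add: pow) (simp add: complex_units_def)
  then show ?thesis by (meson dvd_antisym dvd_refl)
qed

section \<open>Conjugate specializations have the same kernel\<close>

lemma laurent_clear_denominators:
  "\<exists>p n. \<forall>z. z \<noteq> 0 \<longrightarrow> eval_int p z = z ^ n * laurent_eval z f"
proof (induction f rule: laurent_induct)
  case (single k c)
  show ?case
  proof (cases k rule: int_cases2)
    case (nonneg n)
    then show ?thesis
      by (intro exI[of _ "Polynomial.monom c n"] exI[of _ 0]) (simp add: laurent_eval_single)
  next
    case (nonpos n)
    then show ?thesis
      by (intro exI[of _ "[:c:]"] exI[of _ n]) (simp add: laurent_eval_single power_int_minus)
  qed
next
  case (add f g)
  then obtain p n r m where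
    "\<And>z. z \<noteq> 0 \<Longrightarrow> eval_int p z = z ^ n * laurent_eval z f"
    "\<And>z. z \<noteq> 0 \<Longrightarrow> eval_int r z = z ^ m * laurent_eval z g" by blast
  then show ?case
    by (intro exI[of _ "p * Polynomial.monom 1 m + r * Polynomial.monom 1 n"] exI[of _ "n + m"])
       (simp add: laurent_eval_add power_add algebra_simps)
qed

lemma laurent_eval_conjugate:
  assumes "q ^ d = 1" "d > 0" "coprime k d" "laurent_eval (- q) f = 0"
  shows "laurent_eval (- (q ^ k)) f = 0"
proof -
  have q: "q \<noteq> 0" using assms(1,2) by (auto simp: zero_power)
  obtain p n where p: "\<And>z. z \<noteq> 0 \<Longrightarrow> eval_int p z = z ^ n * laurent_eval z f"
    using laurent_clear_denominators by blast
  have neg: "eval_int (pcompose p [:0, -1:]) z = eval_int p (- z)" for z by simp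
  have "eval_int (pcompose p [:0, -1:]) (q ^ k) = 0"
    by (rule root_of_unity_conjugate[OF assms(1-3)]) (use p[of "- q"] q assms(4) in \<open>simp add: neg\<close>)
  then show ?thesis using p[of "- (q ^ k)"] q by (simp add: neg)
qed

lemma primitive_roots_conjugate:
  assumes q: "primitive_root_of_unity d q" and d1: "d \<noteq> 1"
  obtains k where "coprime k d" "q ^ k = cis (2 * pi / d)"
proof -
  have d: "d > 0" "q ^ d = 1" using q by (auto simp: primitive_root_of_unity_def)
  have "q \<in> (\<lambda>k. cis (2 * pi * real k / real d)) ` {..<d}"
    using Complex.bij_betw_roots_unity[OF d(1)] d(2) by (auto simp: bij_betw_def)
  then obtain j where j: "q = cis (2 * pi * real j / real d)" by blast
  then have qj: "q = cis (2 * pi / d) ^ j" by (simp add: Complex.DeMoivre mult_ac)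
  have root: "cis (2 * pi / d) ^ d = 1" using d by (simp add: Complex.DeMoivre)
  have "coprime j d"
  proof (rule ccontr)
    assume "\<not> coprime j d"
    then have g: "gcd j d \<noteq> 1" by (simp add: coprime_iff_gcd_eq_1)
    obtain e where e: "d = gcd j d * e" by (meson dvdE gcd_dvd2)
    obtain i where i: "j = gcd j d * i" by (meson dvdE gcd_dvd1)
    have "j * e = d * i" by (metis e i mult.assoc mult.commute)
    then have "q ^ e = (cis (2 * pi / d) ^ d) ^ i" unfolding qj by (simp flip: power_mult)
    then have "d dvd e" using root primitive_root_power_eq_1_iff[OF q, of e] by simp
    moreover have "0 < e" using e d(1) by (cases e) auto
    ultimately have "d \<le> e" by (auto dest: dvd_imp_le)
    moreover have "gcd j d \<noteq> 0" using d(1) by simp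
    then have "2 \<le> gcd j d" using g by linarith
    then have "2 * e \<le> gcd j d * e" by (rule mult_right_mono) simp
    ultimately show False using e \<open>0 < e\<close> by linarith
  qed
  then obtain k y where k: "j * k = d * y + 1" using coprime_bezout_strong d1 by blast
  have "coprime k d"
  proof (rule coprimeI)
    fix c assume "c dvd k" "c dvd d"
    then have "c dvd j * k" "c dvd d * y" by simp_all
    then show "is_unit c" unfolding k by (simp only: dvd_add_right_iff)
  qed
  moreover have "q ^ k = cis (2 * pi / d) ^ (d * y + 1)" by (simp only: qj flip: power_mult k)
  then have "q ^ k = cis (2 * pi / d)" using root by (simp add: power_add power_mult)
  ultimately show thesis using that by blast
qed

lemma laurent_eval_diff: "laurent_eval z (p - r) = laurent_eval z p - laurent_eval z r"
  using laurent_eval_add[of z "p - r" r] by simp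

text \<open>
  The entries of the Burau matrix are Laurent polynomials with integer coefficients, so their vanishing
  passes to Galois conjugates.
\<close>

lemma burau_kernel_conjugate:
  assumes "q ^ d = 1" "d > 0" "coprime k d"
  shows "kernel B3 GL (burau3_at (- q)) \<subseteq> kernel B3 GL (burau3_at (- (q ^ k)))"
proof
  fix x assume x: "x \<in> kernel B3 GL (burau3_at (- q))"
  have entry: "burau3_at t x = mat 1 \<longleftrightarrow> (\<forall>i j. laurent_eval t (burau3 x $ i $ j - (if i = j then 1 else 0)) = 0)" for t
    unfolding burau3_at_def vec_eq_iff mat_def
    by (auto simp: laurent_eval_diff laurent_eval_one laurent_eval_zero)
  have "burau3_at (- q) x = mat 1" using x by (simp add: kernel_def GL_def)
  then have "burau3_at (- (q ^ k)) x = mat 1"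
    unfolding entry using laurent_eval_conjugate[OF assms] by blast
  then show "x \<in> kernel B3 GL (burau3_at (- (q ^ k)))"
    using x by (simp add: kernel_def GL_def)
qed

section \<open>The kernel of the Burau representation at a root of unity\<close>

theorem theorem5p4:
  fixes d l :: nat and q :: complex and g :: braid_gen
  assumes "d \<ge> 7"
    and "primitive_root_of_unity d q"
    and "l = 2 * d div gcd 12 (d + 6)"
  shows "kernel B3 GL (burau3_at (- q))
           = normal_closure B3 {half_twist g [^]\<^bsub>B3\<^esub> d} <#>\<^bsub>B3\<^esub> generate B3 {full_twist [^]\<^bsub>B3\<^esub> l}
         \<and> group.ord complex_units ((- q) ^ 3) = l"
proof
  have d: "d > 0" "q ^ d = 1" "q \<noteq> 1"
    using assms(1) primitive_root_power_eq_1_iff[OF assms(2), of 1] assms(2)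
    by (auto simp: primitive_root_of_unity_def)
  have q: "q \<noteq> 0" "- q \<noteq> 0" using d by (auto simp: zero_power)
  have order_nat: "((- q) ^ 3) ^ n = 1 \<longleftrightarrow> l dvd n" for n
    by (rule neg_root_cube_power_eq_1_iff[OF assms(2,3)])
  have order: "((- q) ^ 3) powi k = 1 \<longleftrightarrow> int l dvd k" for k
  proof (cases k rule: int_cases2)
    case (nonneg n)
    show ?thesis unfolding nonneg power_int_of_nat order_nat by simp
  next
    case (nonpos n)
    show ?thesis
      unfolding nonpos power_int_minus power_int_of_nat inverse_eq_1_iff order_nat by simp
  qed
  note act_simps = act_mult[OF q(2)] act_scale[OF q(2)] act_full_twist_pow[OF q(2)] act_kernel_iff[OF q(2)]
  have N: "x \<in> twist_powers d \<Longrightarrow> act (- q) x v = v" for x v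
    using twist_powers_subset_kernel[OF q(1) d(2,3)] by (auto simp: act_simps)
  have gen: "generate B3 {full_twist [^]\<^bsub>B3\<^esub> l} = {full_twist [^]\<^bsub>B3\<^esub> (int l * k) | k. True}"
    using B3.generate_pow[of "full_twist [^]\<^bsub>B3\<^esub> l"]
    by (simp add: B3.int_pow_pow flip: int_pow_int)
  have N_eq: "normal_closure B3 {half_twist g [^]\<^bsub>B3\<^esub> d} = twist_powers d"
    unfolding twist_powers_def by (rule normal_closure_half_twist_pow)
  show "kernel B3 GL (burau3_at (- q))
    = normal_closure B3 {half_twist g [^]\<^bsub>B3\<^esub> d} <#>\<^bsub>B3\<^esub> generate B3 {full_twist [^]\<^bsub>B3\<^esub> l}"
    unfolding N_eq
  proof (intro equalityI subsetI)
    fix x assume x: "x \<in> kernel B3 GL (burau3_at (- q))"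
    \<comment> \<open>Pass to the conjugate for which the Burau representation is hyperbolic.\<close>
    obtain k where "coprime k d" "q ^ k = cis (2 * pi / d)"
      using primitive_roots_conjugate[OF assms(2)] assms(1) by auto
    then have "x \<in> kernel B3 GL (burau3_at (- cis (2 * pi / d)))"
      using x burau_kernel_conjugate[OF d(2,1), of k] by auto
    then have "x \<in> twist_kernel d" by (rule trivial_action_in_twist_kernel[OF assms(1)])
    then obtain y k where xy: "x = y \<diamondop> full_twist [^]\<^bsub>B3\<^esub> (k::int)" and y: "y \<in> twist_powers d"
      by (auto simp: twist_kernel_def)
    have "\<forall>v :: complex ^ 2. ((- q) ^ 3) powi k *s v = v"
      using x unfolding xy act_simps by (simp only: N[OF y] HOL.simp_thms)
    from spec[OF this, of "vector [1, 1]"] have "((- q) ^ 3) powi k = 1"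
      by (simp only: vec2_eq_iff vector_smult_component vector_2 mult_1_right)
    then obtain j where "k = int l * j" unfolding order by (rule dvdE)
    then show "x \<in> twist_powers d <#>\<^bsub>B3\<^esub> generate B3 {full_twist [^]\<^bsub>B3\<^esub> l}"
      unfolding set_mult_def gen using xy y by auto
  next
    fix x assume "x \<in> twist_powers d <#>\<^bsub>B3\<^esub> generate B3 {full_twist [^]\<^bsub>B3\<^esub> l}"
    then obtain y j where x: "x = y \<diamondop> full_twist [^]\<^bsub>B3\<^esub> (int l * j)" and y: "y \<in> twist_powers d"
      unfolding set_mult_def gen by auto
    have "((- q) ^ 3) powi (int l * j) = 1" unfolding order by simp
    then show "x \<in> kernel B3 GL (burau3_at (- q))"
      unfolding x act_simps by (simp only: N[OF y] vector_smult_lid HOL.simp_thms)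
  qed
  show "group.ord complex_units ((- q) ^ 3) = l"
    by (rule order_neg_root_cube[OF assms(2,3)])
qed

end
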